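(* Let $\Lambda\in X_Q$ be a generic Taylor--Socolar tiling with $\xi(\Lambda)={\bf q}$. Then the parity function of $\Lambda$ is $\mathbb P_{\bf q}$: for every $x\in Q$ the parity ($1$ for white, $0$ for gray) of the tile of $\Lambda$ at $x$ equals $\mathbb P_{\bf q}(x)$.
   Context: Lattices. $a_1=(1,0)$, $a_2=(-\tfrac12,\tfrac{\sqrt3}2)$, $Q=\mathbb Za_1+\mathbb Za_2\subset\mathbb R^2$, $w_1=\tfrac23a_1+\tfrac13a_2$, $w_2=\tfrac13a_1+\tfrac23a_2$, $\Omega=\{\pm w_1,\pm w_2,\pm(w_2-w_1)\}$. $\overline Q$ is the completion of $Q$ for the topology with neighborhood basis $2^kQ$ of $0$. Write ${\bf q}\in\overline Q$ as ${\bf q}=\lim_kv_k$, $v_0=0$, $v_k=q_1+\dots+q_k$, $q_k\in2^{k-1}Q$. Parity function. Triple coordinates: $x=ma_1+na_2\in Q$ has triple coordinates $(x_1,x_2,x_3)=(n,-m,m-n)$, so $x_1+x_2+x_3=0$ (equivalently, with $a_3=-(a_1+a_2)$, $x_1$ is the $a_2$-coordinate of the point where the line through $x$ parallel to $a_1$ meets the $a_2$-axis, and cyclically). For a nonzero integer $z$, $D(z)$ is the largest power of $2$ dividing $z$; $D(0)=\infty$. For $x\in Q$, with subscripts modulo 3, $$\mathbb P(x)=\left\lfloor\frac{x_{j+2}}{D(x_{j+2}-x_{j+1})}\right\rfloor+\left\lfloor\frac{x_{j+2}}{D(x_{j+2}+x_{j+1})}\right\rfloor\bmod2,$$ where $j$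 is such that $D(x_j)$ is the maximum of $D(x_1),D(x_2),D(x_3)$, provided $x_{j+1}\pm x_{j+2}\ne0$. For generic ${\bf q}$ and $x\in Q$, $\mathbb P(x-v_k)$ is defined and constant for all large $k$, and $\mathbb P_{\bf q}(x)$ denotes this eventual value. Triangulations. $\mathcal T({\bf q})$ is the family of triangulations of the plane, one for each $k\ge0$, by equilateral triangles of side $2^k$ with vertex set $v_k+2^kQ$ (triangles, and edges, of level $k$). An a-line is a line through a point of $Q$ in one of the directions $a_1,a_2,a_1+a_2$; its level is the supremum of the $k$ such that it contains a level-$k$ edge. A w-line is a line through a point of $Q$ in one of the directions $w_1,w_2,w_2-w_1$; its level is the supremum of the $k$ such that it contains a centroid of a level-$k$ triangle. ${\bf q}$ is generic if all a-lines and all w-lines have finite level; $\Lambda$ is generic if $\xi(\Lambda)$ is. Tiles and matching rules. The hexagon $H_x$ at $x\in Q$ is the regular hexagon with center $x$ and vertices $x+w$, $w\in\Omega$. A marked tile at $x$ is given by: a stripe direction (one of the lines $\mathbb Ra_1,\mathbb Ra_2,\mathbb R(a_1+a_2)$); a black stripe across $H_x$ parallel to that direction and displaced from $x$ by a fixed small $\epsilon>0$ ($0<\epsilon\le1/4$) to one of the two sides; two further black V-shaped lines, one on each side, each joining the two hexagon edges adjacent to the vertex of $H_x$ lying on that side on the long diagonal perpendicular to the stripe direction, with legs perpendicular to these edges and displaced by $\epsilon$ from the edge midpoints towards that vertex; the long diagonal at angle $\pi/6$ clockwise from the stripe direction colored red, the one at $\pi/6$ counterclockwise colored blue, and the one perpendicular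 to the stripe direction colored half red and half blue (either way around, split at $x$). The tile is white if the displaced stripe crosses the red half of the split diagonal and gray if it crosses the blue half. $X_Q$ is the set of all choices of a marked tile at every $x\in Q$ such that: (R1) on each common edge of two adjacent hexagons the black lines of the two tiles meet (same displacement from the edge midpoint); (R2) for all $x\in Q$, $w\in\Omega$, the color at the end $x+w$ of the diagonal of $H_x$ and the color at the end $x+2w$ of the diagonal of $H_{x+3w}$ are opposite. The map $\xi$. For each $\Lambda\in X_Q$ there is a unique ${\bf q}=\xi(\Lambda)\in\overline Q$ such that for each $x\in Q$ (other than a point lying on three a-lines of infinite level) the stripe direction at $x$ is that of the a-line through $x$ of strictly largest level in $\mathcal T({\bf q})$, and, if this level is a finite number $k$, the stripe is displaced towards the centroid of the unique level-$(k+1)$ triangle having as a midsegment the level-$k$ edge that contains $x$. *)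

theory Defs
  imports "HOL-Analysis.Analysis"
begin

text \<open>The Euclidean plane is the type of complex numbers, so that rotation by an angle
  \<open>\<theta>\<close> is multiplication by \<open>cis \<theta>\<close> and by a right angle is multiplication by \<open>\<i>\<close>.\<close>

section \<open>The lattice and its 2-adic completion\<close>

definition a1 :: complex where "a1 = 1"
definition a2 :: complex where "a2 = Complex (- 1 / 2) (sqrt 3 / 2)"

definition Q :: "complex set" where
  "Q = {of_int m * a1 + of_int n * a2 | m n. True}"

definition w1 :: complex where "w1 = (2 / 3) * a1 + (1 / 3) * a2"
definition w2 :: complex where "w2 = (1 / 3) * a1 + (2 / 3) * a2"

definition Omega :: "complex set" where
  "Omega = {w1, - w1, w2, - w2, w2 - w1, - (w2 - w1)}"

definition pow2Q :: "nat \<Rightarrow> complex set" where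
  "pow2Q k = (\<lambda>x. 2 ^ k * x) ` Q"

definition Cauchy_Q :: "(nat \<Rightarrow> complex) set" where
  "Cauchy_Q = {s. range s \<subseteq> Q \<and> (\<forall>k. \<exists>N. \<forall>m\<ge>N. \<forall>n\<ge>N. s m - s n \<in> pow2Q k)}"

definition null_rel :: "((nat \<Rightarrow> complex) \<times> (nat \<Rightarrow> complex)) set" where
  "null_rel = {(s, t). s \<in> Cauchy_Q \<and> t \<in> Cauchy_Q \<and>
     (\<forall>k. \<exists>N. \<forall>n\<ge>N. s n - t n \<in> pow2Q k)}"

text \<open>The topology with neighbourhood basis \<open>pow2Q k\<close> of 0 is metrizable, so the completion
  consists of the Cauchy sequences modulo null sequences.\<close>

definition Qbar :: "(nat \<Rightarrow> complex) set set" where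
  "Qbar = Cauchy_Q // null_rel"

text \<open>\<open>represents v q\<close>: \<open>v k = q\<^sub>1 + \<dots> + q\<^sub>k\<close> with \<open>q\<^sub>k \<in> 2\<^sup>k\<^sup>-\<^sup>1 Q\<close>, and \<open>q\<close> is the limit of the
  \<open>v k\<close>.  The limit in the completion of a Cauchy sequence in \<open>Q\<close> is its own class, so the
  latter says \<open>v \<in> q\<close>.  The sequence \<open>v\<close> is not unique, but \<open>v k\<close> is determined
  by \<open>q\<close> modulo \<open>pow2Q k\<close>.\<close>

definition represents :: "(nat \<Rightarrow> complex) \<Rightarrow> (nat \<Rightarrow> complex) set \<Rightarrow> bool" where
  "represents v q \<longleftrightarrow> v \<in> q \<and> v 0 = 0 \<and> (\<forall>k. v (Suc k) - v k \<in> pow2Q k)"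

section \<open>The parity function\<close>

definition lattice_coords :: "complex \<Rightarrow> int \<times> int" where
  "lattice_coords x = (THE (m, n). x = of_int m * a1 + of_int n * a2)"

text \<open>\<open>triple x j\<close> is the coordinate \<open>x\<^sub>j\<close>, the index being read modulo 3.\<close>

definition triple :: "complex \<Rightarrow> nat \<Rightarrow> int" where
  "triple x j = (case lattice_coords x of (m, n) \<Rightarrow>
     if j mod 3 = 1 then n else if j mod 3 = 2 then - m else m - n)"

definition D :: "int \<Rightarrow> enat" where
  "D z = (if z = 0 then \<infinity> else enat (2 ^ multiplicity 2 z))"

definition max_index :: "complex \<Rightarrow> nat" where
  "max_index x = (SOME j. j \<in> {1, 2, 3} \<and> (\<forall>i\<in>{1, 2, 3}. D (triple x i) \<le> D (triple x j)))"

definition floor_quot :: "int \<Rightarrow> int \<Rightarrow> int" where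
  "floor_quot y z = \<lfloor>real_of_int y / real (the_enat (D z))\<rfloor>"

text \<open>The value \<open>None\<close> stands for ``undefined''.  For \<open>x \<in> Q\<close> the index of maximal \<open>D\<close> is unique
  unless \<open>x = 0\<close>, where the parity is undefined whatever the choice.\<close>

definition parity_fun :: "complex \<Rightarrow> int option" where
  "parity_fun x =
     (let j = max_index x; y = triple x (j + 1); z = triple x (j + 2)
      in if y + z \<noteq> 0 \<and> y - z \<noteq> 0
         then Some ((floor_quot z (z - y) + floor_quot z (z + y)) mod 2)
         else None)"

text \<open>All choices of \<open>v\<close> are required to give the same eventual value.\<close>

definition eventual_parity :: "(nat \<Rightarrow> complex) set \<Rightarrow> complex \<Rightarrow> int \<Rightarrow> bool" where
  "eventual_parity q x p \<longleftrightarrow>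
     (\<forall>v. represents v q \<longrightarrow> (\<forall>\<^sub>F k in sequentially. parity_fun (x - v k) = Some p))"

definition parity_fun_at :: "(nat \<Rightarrow> complex) set \<Rightarrow> complex \<Rightarrow> int option" where
  "parity_fun_at q x =
     (if \<exists>!p. eventual_parity q x p then Some (THE p. eventual_parity q x p) else None)"

section \<open>The triangulations\<close>

definition level_vertices :: "(nat \<Rightarrow> complex) set \<Rightarrow> nat \<Rightarrow> complex set" where
  "level_vertices q k = {y. \<exists>v. represents v q \<and> y - v k \<in> pow2Q k}"

text \<open>The least distance between points of \<open>level_vertices q k\<close> is \<open>2 ^ k\<close>, so pairs and triples at
  this mutual distance are exactly the edges and triangles of the triangulation.\<close>

definition level_edge :: "(nat \<Rightarrow> complex) set \<Rightarrow> nat \<Rightarrow> complex set \<Rightarrow> bool" where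
  "level_edge q k e \<longleftrightarrow>
     (\<exists>A\<in>level_vertices q k. \<exists>B\<in>level_vertices q k. dist A B = 2 ^ k \<and> e = closed_segment A B)"

definition level_triangle ::
    "(nat \<Rightarrow> complex) set \<Rightarrow> nat \<Rightarrow> complex \<Rightarrow> complex \<Rightarrow> complex \<Rightarrow> bool" where
  "level_triangle q k A B C \<longleftrightarrow>
     A \<in> level_vertices q k \<and> B \<in> level_vertices q k \<and> C \<in> level_vertices q k \<and>
     dist A B = 2 ^ k \<and> dist B C = 2 ^ k \<and> dist C A = 2 ^ k"

definition centroid :: "complex \<Rightarrow> complex \<Rightarrow> complex \<Rightarrow> complex" where
  "centroid A B C = (A + B + C) / 3"

definition line_through :: "complex \<Rightarrow> complex \<Rightarrow> complex set" where
  "line_through x d = {x + of_real t * d | t. True}"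

definition a_dirs :: "complex set" where "a_dirs = {a1, a2, a1 + a2}"
definition w_dirs :: "complex set" where "w_dirs = {w1, w2, w2 - w1}"

definition a_lines :: "complex set set" where
  "a_lines = {line_through x d | x d. x \<in> Q \<and> d \<in> a_dirs}"

definition w_lines :: "complex set set" where
  "w_lines = {line_through x d | x d. x \<in> Q \<and> d \<in> w_dirs}"

definition a_level :: "(nat \<Rightarrow> complex) set \<Rightarrow> complex set \<Rightarrow> enat" where
  "a_level q l = (SUP k\<in>{k. \<exists>e. level_edge q k e \<and> e \<subseteq> l}. enat k)"

definition w_level :: "(nat \<Rightarrow> complex) set \<Rightarrow> complex set \<Rightarrow> enat" where
  "w_level q l = (SUP k\<in>{k. \<exists>A B C. level_triangle q k A B C \<and> centroid A B C \<in> l}. enat k)"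

definition generic :: "(nat \<Rightarrow> complex) set \<Rightarrow> bool" where
  "generic q \<longleftrightarrow> (\<forall>l\<in>a_lines. a_level q l \<noteq> \<infinity>) \<and> (\<forall>l\<in>w_lines. w_level q l \<noteq> \<infinity>)"

section \<open>Marked tiles and the matching rules\<close>

definition hexagon :: "complex \<Rightarrow> complex set" where
  "hexagon x = convex hull ((\<lambda>w. x + w) ` Omega)"

text \<open>A marked tile amounts to its stripe direction, the side to which the stripe is displaced
  and the side of the red half of the split diagonal.  Sides are given by the unit normals
  \<open>\<plusminus>\<i> d\<close> of the stripe direction \<open>d\<close>; the vertices of the hexagon on the split diagonal are
  \<open>x \<plusminus> \<i> d / \<surd>3\<close>.\<close>

record tile =
  stripe_dir :: complex
  stripe_side :: complex
  red_side :: complex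

definition is_tile :: "tile \<Rightarrow> bool" where
  "is_tile t \<longleftrightarrow> stripe_dir t \<in> a_dirs \<and>
     stripe_side t \<in> {\<i> * stripe_dir t, - (\<i> * stripe_dir t)} \<and>
     red_side t \<in> {\<i> * stripe_dir t, - (\<i> * stripe_dir t)}"

text \<open>The edges crossed by the stripe have midpoints \<open>x \<plusminus> d / 2\<close>.\<close>

definition stripe :: "real \<Rightarrow> complex \<Rightarrow> tile \<Rightarrow> complex set" where
  "stripe eps x t =
     closed_segment (x + of_real eps * stripe_side t - stripe_dir t / 2)
                    (x + of_real eps * stripe_side t + stripe_dir t / 2)"

text \<open>For a unit normal \<open>n\<close>, the edges adjacent to the vertex \<open>x + n / \<surd>3\<close> have midpoints
  \<open>x + cis (\<plusminus>pi / 6) * n / 2\<close>.  The perpendiculars to them at displacement \<open>eps\<close> towards that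
  vertex meet in \<open>x + 2 * eps * n\<close>.\<close>

definition v_end :: "real \<Rightarrow> complex \<Rightarrow> complex \<Rightarrow> real \<Rightarrow> complex" where
  "v_end eps x n \<theta> =
     (let mid = x + cis \<theta> * n / 2; vertex = x + n / of_real (sqrt 3)
      in mid + of_real eps * sgn (vertex - mid))"

definition v_line :: "real \<Rightarrow> complex \<Rightarrow> complex \<Rightarrow> complex set" where
  "v_line eps x n =
     closed_segment (v_end eps x n (pi / 6)) (x + of_real (2 * eps) * n) \<union>
     closed_segment (v_end eps x n (- pi / 6)) (x + of_real (2 * eps) * n)"

definition black :: "real \<Rightarrow> complex \<Rightarrow> tile \<Rightarrow> complex set" where
  "black eps x t = stripe eps x t \<union>
     v_line eps x (\<i> * stripe_dir t) \<union> v_line eps x (- (\<i> * stripe_dir t))"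

text \<open>The segment from the centre to the vertex in the direction of the unit vector \<open>u\<close>.\<close>

definition half_diagonal :: "complex \<Rightarrow> complex \<Rightarrow> complex set" where
  "half_diagonal x u = closed_segment x (x + u / of_real (sqrt 3))"

definition diagonal :: "complex \<Rightarrow> complex \<Rightarrow> complex set" where
  "diagonal x u = half_diagonal x u \<union> half_diagonal x (- u)"

definition red :: "complex \<Rightarrow> tile \<Rightarrow> complex set" where
  "red x t = diagonal x (cis (- pi / 6) * stripe_dir t) \<union> half_diagonal x (red_side t)"

definition blue :: "complex \<Rightarrow> tile \<Rightarrow> complex set" where
  "blue x t = diagonal x (cis (pi / 6) * stripe_dir t) \<union> half_diagonal x (- red_side t)"

definition white :: "real \<Rightarrow> complex \<Rightarrow> tile \<Rightarrow> bool" where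
  "white eps x t \<longleftrightarrow> stripe eps x t \<inter> half_diagonal x (red_side t) \<noteq> {}"

definition tile_parity :: "real \<Rightarrow> complex \<Rightarrow> tile \<Rightarrow> int" where
  "tile_parity eps x t = (if white eps x t then 1 else 0)"

text \<open>Hexagons are adjacent if their centres are at distance 1, and then intersect in the common
  edge.  The black lines of a tile meet each edge in exactly one point.\<close>

definition R1 :: "real \<Rightarrow> (complex \<Rightarrow> tile) \<Rightarrow> bool" where
  "R1 eps \<Lambda> \<longleftrightarrow> (\<forall>x\<in>Q. \<forall>y\<in>Q. dist x y = 1 \<longrightarrow>
     black eps x (\<Lambda> x) \<inter> (hexagon x \<inter> hexagon y) =
     black eps y (\<Lambda> y) \<inter> (hexagon x \<inter> hexagon y))"

text \<open>Each vertex of a hexagon lies in exactly one of the red and the blue set of its tile.\<close>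

definition R2 :: "(complex \<Rightarrow> tile) \<Rightarrow> bool" where
  "R2 \<Lambda> \<longleftrightarrow> (\<forall>x\<in>Q. \<forall>w\<in>Omega.
     x + w \<in> red x (\<Lambda> x) \<longleftrightarrow> x + 2 * w \<in> blue (x + 3 * w) (\<Lambda> (x + 3 * w)))"

text \<open>Only the values of \<open>\<Lambda>\<close> on \<open>Q\<close> matter.\<close>

definition X_Q :: "real \<Rightarrow> (complex \<Rightarrow> tile) set" where
  "X_Q eps = {\<Lambda>. (\<forall>x\<in>Q. is_tile (\<Lambda> x)) \<and> R1 eps \<Lambda> \<and> R2 \<Lambda>}"

text \<open>\<open>is_xi \<Lambda> q\<close> is the property characterizing \<open>q = \<xi>(\<Lambda>)\<close>.  The triangle \<open>A B C\<close> below
  is unique, and displacement towards its centroid means that the side of the stripe is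
  the side of the line through \<open>x\<close> on which the centroid lies.\<close>

definition is_xi :: "(complex \<Rightarrow> tile) \<Rightarrow> (nat \<Rightarrow> complex) set \<Rightarrow> bool" where
  "is_xi \<Lambda> q \<longleftrightarrow> q \<in> Qbar \<and>
     (\<forall>x\<in>Q. (\<exists>d\<in>a_dirs. a_level q (line_through x d) \<noteq> \<infinity>) \<longrightarrow>
        (\<forall>d\<in>a_dirs - {stripe_dir (\<Lambda> x)}.
           a_level q (line_through x d) < a_level q (line_through x (stripe_dir (\<Lambda> x)))) \<and>
        (\<forall>k. a_level q (line_through x (stripe_dir (\<Lambda> x))) = enat k \<longrightarrow>
           (\<exists>A B C. level_triangle q (Suc k) A B C \<and>
              level_edge q k (closed_segment (midpoint A B) (midpoint A C)) \<and>
              x \<in> closed_segment (midpoint A B) (midpoint A C) \<and>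
              stripe_side (\<Lambda> x) \<bullet> (centroid A B C - x) > 0)))"

end

theory Submission
  imports Defs
begin

text \<open>Fix a sequence \<open>v\<close> representing \<open>q\<close>, a point \<open>x\<close> of the lattice and a large \<open>k\<close>.  Write \<open>N, y, z\<close>
  for the triple coordinates of \<open>x - v k\<close> with indices \<open>j, j + 1, j + 2\<close>, so that \<open>N + y + z = 0\<close>, where
  \<open>j\<close> numbers the stripe direction of the tile at \<open>x\<close>.  Rotating by \<open>2 * pi / 3\<close> permutes the three
  directions cyclically, so everything is done in the frame of the unit vectors \<open>e\<close> (of number \<open>j\<close>)
  and \<open>a2 * e\<close> without distinguishing the directions.

  An a-line of direction \<open>j\<close> contains a level-\<open>s\<close> edge, for \<open>s \<le> k\<close>, exactly if \<open>2 ^ s\<close> divides the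
  \<open>j\<close>-th coordinate of its points relative to \<open>v k\<close> (\<open>a_level_ge_iff\<close>).  Hence the stripe follows the coordinate with
  the largest power of 2, which is the index chosen in the parity function.  The tile is white if and
  only if the stripe is displaced to the side of the red half of the split diagonal (\<open>white_iff\<close>), and
  the two summands of the parity function describe these two sides.

  The side of the stripe (\<open>stripe_side_iff\<close>).  Let \<open>2 ^ l\<close> be the exact power of 2 in \<open>N\<close>.  The level-\<open>l\<close>
  edges on the line of the stripe are alternately midsegments of upward and of downward triangles of
  level \<open>l + 1\<close>.  So the side depends on the parity of the position of the edge containing \<open>x\<close>, which is
  \<open>- y div 2 ^ l\<close> and differs from \<open>z div 2 ^ l\<close> by the odd number \<open>N div 2 ^ l\<close>.

  The side of the red half (\<open>red_side_iff\<close>).  By the rule R2 the colour at the end of the split diagonal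
  is passed on along the w-line perpendicular to the stripe, from \<open>x\<close> to \<open>x + 3 * w\<close> and so on, unchanged as
  long as the stripe direction stays the same.  At the first tile with another stripe direction the
  diagonal in question has a single colour, which is known.  Along the way \<open>c = z - y\<close> is constant
  while \<open>z\<close> decreases by 1 in each step.  If \<open>2 ^ r\<close> is the exact power of 2 in \<open>c\<close>, the stripe direction
  changes for the first time when \<open>z\<close> reaches the multiple \<open>2 ^ r * (z div 2 ^ r)\<close>, and the parity of
  \<open>z div 2 ^ r\<close> decides which of the two other directions occurs there.

  Genericity makes \<open>N\<close> and \<open>c\<close> nonzero with an exact power of 2 that is eventually smaller than \<open>2 ^ k\<close>:
  finite levels of a-lines give this for \<open>N\<close>, finite levels of w-lines for \<open>c\<close>.\<close>

section \<open>Rotation-symmetric lattice frames\<close>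

text \<open>For \<open>j = 1, 2, 3\<close> these are \<open>a1\<close>, \<open>a2\<close> and \<open>a3 = - (a1 + a2)\<close>.  The offset makes the index agree,
  modulo 3, with that of the triple coordinates while keeping the exponent a natural number.\<close>

definition a_unit :: "nat \<Rightarrow> complex" where "a_unit j = a2 ^ (j + 2)"

lemma a2_square: "a2\<^sup>2 = - 1 - a2"
  by (simp add: a2_def complex_eq_iff power2_eq_square)

lemma a2_cube: "a2 ^ 3 = 1"
proof -
  have "a2 ^ 3 = a2 * a2\<^sup>2" by (simp add: power2_eq_square power3_eq_cube)
  also have "\<dots> = - a2 - a2\<^sup>2" by (subst a2_square) (simp add: right_diff_distrib flip: power2_eq_square)
  finally show ?thesis unfolding a2_square by simp
qed

lemma a_unit_add3 [simp]: "a_unit (j + 3) = a_unit j"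
proof -
  have "a_unit (j + 3) = a2 ^ (j + 2) * a2 ^ 3" unfolding a_unit_def
    by (subst power_add[symmetric]) (simp add: add.commute add.left_commute)
  then show ?thesis by (simp add: a2_cube a_unit_def)
qed

lemma a_unit_add1: "a_unit (j + 1) = a2 * a_unit j"
  by (simp add: a_unit_def)

lemma a_unit_add2: "a_unit (j + 2) = - a_unit j - a_unit (j + 1)"
proof -
  have "a_unit (j + 2) = a2\<^sup>2 * a_unit j" by (simp add: a_unit_def power_add power2_eq_square)
  then show ?thesis unfolding a2_square a_unit_add1 by (simp add: algebra_simps)
qed

lemma a_unit_mod3: "a_unit (j mod 3) = a_unit j"
proof -
  have "a_unit (i + 3 * n) = a_unit i" for i n
  proof (induction n)
    case (Suc n)
    have "a_unit (i + 3 * Suc n) = a_unit ((i + 3 * n) + 3)" by (simp add: algebra_simps)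
    then show ?case using Suc by simp
  qed simp
  from this[of "j mod 3" "j div 3"] show ?thesis by (simp add: mod_mult_div_eq)
qed

lemma a_unit_1: "a_unit 1 = a1" and a_unit_2: "a_unit 2 = a2" and a_unit_0: "a_unit 0 = - (a1 + a2)"
proof -
  show "a_unit 1 = a1" using a2_cube by (simp add: a_unit_def a1_def eval_nat_numeral)
  show "a_unit 2 = a2" using a2_cube by (simp add: a_unit_def eval_nat_numeral)
  show "a_unit 0 = - (a1 + a2)" by (simp add: a_unit_def a1_def a2_square numeral_2_eq_2[symmetric])
qed

lemma norm_a_unit [simp]: "cmod (a_unit j) = 1"
proof -
  have "cmod a2 = 1" by (simp add: a2_def cmod_def power2_eq_square)
  then show ?thesis by (simp add: a_unit_def norm_power norm_mult)
qed

lemma a_unit_nonzero [simp]: "a_unit j \<noteq> 0"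
  using norm_a_unit[of j] by (metis norm_zero zero_neq_one)

lemma lattice_coords_eq: "lattice_coords (of_int m * a1 + of_int n * a2) = (m, n)"
proof -
  have *: "m = m' \<and> n = n'" if "of_int m * a1 + of_int n * a2 = of_int m' * a1 + of_int n' * a2"
    for m' n'
    using that by (simp add: a1_def a2_def complex_eq_iff)
  show ?thesis unfolding lattice_coords_def
    by (rule the_equality) (use * in \<open>auto\<close>)
qed

definition frame_point :: "nat \<Rightarrow> int \<Rightarrow> int \<Rightarrow> complex" where
  "frame_point j m n = of_int m * a_unit j + of_int n * a_unit (j + 1)"

text \<open>In each of the three frames the triple coordinates are obtained from the frame coordinates by
  the same formula; this is what lets the rest of the proof ignore which direction \<open>j\<close> is.\<close>

lemma frame_point_props:
  shows frame_point_in_Q: "frame_point j m n \<in> Q"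
    and triple_frame_point: "triple (frame_point j m n) j = n"
       "triple (frame_point j m n) (j + 1) = - m"
       "triple (frame_point j m n) (j + 2) = m - n"
proof -
  consider "j mod 3 = 0" | "j mod 3 = 1" | "j mod 3 = 2" by fastforce
  then have "frame_point j m n \<in> Q \<and> triple (frame_point j m n) j = n \<and>
      triple (frame_point j m n) (j + 1) = - m \<and> triple (frame_point j m n) (j + 2) = m - n"
  proof cases
    case 1
    have md: "(j + 1) mod 3 = 1" "(j + 2) mod 3 = 2" using 1 by presburger+
    have ax: "a_unit j = - (a1 + a2)" "a_unit (j + 1) = a1"
      using 1 md(1) a_unit_mod3[of j] a_unit_mod3[of "j + 1"] a_unit_0 a_unit_1 by metis+
    have "frame_point j m n = of_int (n - m) * a1 + of_int (- m) * a2"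
      unfolding frame_point_def ax by (simp add: algebra_simps)
    then show ?thesis using 1 md unfolding Q_def triple_def
      by (auto simp: lattice_coords_eq simp del: of_int_diff of_int_minus)
  next
    case 2
    have md: "(j + 1) mod 3 = 2" "(j + 2) mod 3 = 0" using 2 by presburger+
    have ax: "a_unit j = a1" "a_unit (j + 1) = a2"
      using 2 md(1) a_unit_mod3[of j] a_unit_mod3[of "j + 1"] a_unit_1 a_unit_2 by metis+
    have "frame_point j m n = of_int m * a1 + of_int n * a2"
      unfolding frame_point_def ax by (simp add: algebra_simps)
    then show ?thesis using 2 md unfolding Q_def triple_def
      by (auto simp: lattice_coords_eq)
  next
    case 3
    have md: "(j + 1) mod 3 = 0" "(j + 2) mod 3 = 1" using 3 by presburger+
    have ax: "a_unit j = a2" "a_unit (j + 1) = - (a1 + a2)"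
      using 3 md(1) a_unit_mod3[of j] a_unit_mod3[of "j + 1"] a_unit_0 a_unit_2 by metis+
    have "frame_point j m n = of_int (- n) * a1 + of_int (m - n) * a2"
      unfolding frame_point_def ax by (simp add: algebra_simps)
    then show ?thesis using 3 md unfolding Q_def triple_def
      by (auto simp: lattice_coords_eq simp del: of_int_diff of_int_minus)
  qed
  then show "frame_point j m n \<in> Q" "triple (frame_point j m n) j = n"
       "triple (frame_point j m n) (j + 1) = - m"
       "triple (frame_point j m n) (j + 2) = m - n" by blast+
qed

lemma Q_frame:
  assumes "x \<in> Q"
  obtains m n where "x = frame_point j m n"
proof -
  obtain a b where x: "x = of_int a * a1 + of_int b * a2" using assms unfolding Q_def by blast
  consider "j mod 3 = 0" | "j mod 3 = 1" | "j mod 3 = 2" by fastforce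
  then show thesis
  proof cases
    case 1
    then have md: "(j + 1) mod 3 = 1" by presburger
    have ax: "a_unit j = - (a1 + a2)" "a_unit (j + 1) = a1"
      using 1 md a_unit_mod3[of j] a_unit_mod3[of "j + 1"] a_unit_0 a_unit_1 by metis+
    have "x = frame_point j (- b) (a - b)"
      unfolding x frame_point_def ax by (simp add: algebra_simps)
    then show ?thesis by (rule that)
  next
    case 2
    then have md: "(j + 1) mod 3 = 2" by presburger
    have ax: "a_unit j = a1" "a_unit (j + 1) = a2"
      using 2 md a_unit_mod3[of j] a_unit_mod3[of "j + 1"] a_unit_1 a_unit_2 by metis+
    have "x = frame_point j a b" unfolding x frame_point_def ax ..
    then show ?thesis by (rule that)
  next
    case 3
    then have md: "(j + 1) mod 3 = 0" by presburger
    have ax: "a_unit j = a2" "a_unit (j + 1) = - (a1 + a2)"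
      using 3 md a_unit_mod3[of j] a_unit_mod3[of "j + 1"] a_unit_0 a_unit_2 by metis+
    have "x = frame_point j (b - a) (- a)"
      unfolding x frame_point_def ax by (simp add: algebra_simps)
    then show ?thesis by (rule that)
  qed
qed

lemma frame_point_arith:
  "frame_point j m n + frame_point j m' n' = frame_point j (m + m') (n + n')"
  "frame_point j m n - frame_point j m' n' = frame_point j (m - m') (n - n')"
  "of_int s * frame_point j m n = frame_point j (s * m) (s * n)"
  by (simp_all add: frame_point_def algebra_simps)

lemma Q_add: "x \<in> Q \<Longrightarrow> y \<in> Q \<Longrightarrow> x + y \<in> Q"
  by (metis Q_frame frame_point_arith(1) frame_point_in_Q)

lemma Q_diff: "x \<in> Q \<Longrightarrow> y \<in> Q \<Longrightarrow> x - y \<in> Q"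
  by (metis Q_frame frame_point_arith(2) frame_point_in_Q)

lemma triple_diff: 
  assumes "x \<in> Q" "y \<in> Q" shows "triple (x - y) j = triple x j - triple y j"
proof -
  obtain m n where x: "x = frame_point j m n" using assms(1) by (rule Q_frame)
  obtain m' n' where y: "y = frame_point j m' n'" using assms(2) by (rule Q_frame)
  show ?thesis by (simp add: x y frame_point_arith triple_frame_point)
qed

lemma triple_sum: 
  assumes "x \<in> Q" shows "triple x j + triple x (j + 1) + triple x (j + 2) = 0"
proof -
  obtain m n where x: "x = frame_point j m n" using assms(1) by (rule Q_frame)
  show ?thesis unfolding x triple_frame_point by simp
qed

lemma pow2Q_frame_point: "frame_point j m n \<in> pow2Q k \<longleftrightarrow> 2 ^ k dvd m \<and> 2 ^ k dvd n"
proof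
  assume "frame_point j m n \<in> pow2Q k"
  then obtain y where y: "y \<in> Q" "frame_point j m n = 2 ^ k * y" unfolding pow2Q_def by blast
  obtain m' n' where "y = frame_point j m' n'" using y(1) by (rule Q_frame)
  then have "frame_point j m n = frame_point j (2 ^ k * m') (2 ^ k * n')"
    using y(2) frame_point_arith(3)[of "2 ^ k" j m' n'] by simp
  then have "n = 2 ^ k * n'" "- m = - (2 ^ k * m')" by (metis triple_frame_point)+
  then show "2 ^ k dvd m \<and> 2 ^ k dvd n" by auto
next
  assume "2 ^ k dvd m \<and> 2 ^ k dvd n"
  then obtain m' n' where "m = 2 ^ k * m'" "n = 2 ^ k * n'" unfolding dvd_def by blast
  then have "frame_point j m n = 2 ^ k * frame_point j m' n'"
    using frame_point_arith(3)[of "2 ^ k" j m' n'] by simp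
  then show "frame_point j m n \<in> pow2Q k" unfolding pow2Q_def using frame_point_in_Q by blast
qed

lemma pow2Q_sub_Q: 
  assumes "y \<in> pow2Q k" shows "y \<in> Q"
proof -
  obtain x where x: "x \<in> Q" "y = 2 ^ k * x" using assms unfolding pow2Q_def by blast
  obtain m n where "x = frame_point 0 m n" using x(1) by (rule Q_frame)
  then have "y = frame_point 0 (2 ^ k * m) (2 ^ k * n)"
    using x(2) frame_point_arith(3)[of "2 ^ k" 0 m n] by simp
  then show ?thesis by (simp add: frame_point_in_Q)
qed

lemma pow2Q_triple: 
  assumes "y \<in> pow2Q k" shows "2 ^ k dvd triple y j"
proof -
  obtain m n where "y = frame_point j m n" using pow2Q_sub_Q[OF assms] by (rule Q_frame)
  then show ?thesis using assms by (simp add: pow2Q_frame_point triple_frame_point)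
qed

lemma pow2Q_add: "x \<in> pow2Q k \<Longrightarrow> y \<in> pow2Q k \<Longrightarrow> x + y \<in> pow2Q k"
  unfolding pow2Q_def by (auto simp flip: distrib_left intro: Q_add)

lemma pow2Q_diff: "x \<in> pow2Q k \<Longrightarrow> y \<in> pow2Q k \<Longrightarrow> x - y \<in> pow2Q k"
  unfolding pow2Q_def by (auto simp flip: right_diff_distrib intro: Q_diff)

lemma pow2Q_antimono:
  assumes "k \<le> l" "x \<in> pow2Q l" shows "x \<in> pow2Q k"
proof -
  obtain m n where x: "x = frame_point 0 m n" using pow2Q_sub_Q[OF assms(2)] by (rule Q_frame)
  have "(2::int) ^ k dvd 2 ^ l" using assms(1) by (rule le_imp_power_dvd)
  then show ?thesis using assms(2) unfolding x pow2Q_frame_point by (meson dvd_trans)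
qed

lemma zero_in_pow2Q: "0 \<in> pow2Q k"
  using pow2Q_frame_point[of 0 0 0 k] by (simp add: frame_point_def)

lemma zero_in_Q: "0 \<in> Q" using frame_point_in_Q[of 0 0 0] by (simp add: frame_point_def)

lemma pow2Q_0: "pow2Q 0 = Q" by (simp add: pow2Q_def)

section \<open>Representing sequences and vertices of a level\<close>

text \<open>Passing to a subsequence of a Cauchy sequence makes its increments as small as required.  The
  existence of a representing sequence guarantees that the eventual parity has at most one value.\<close>

lemma represents_exists:
  assumes "q \<in> Qbar" obtains v where "represents v q"
proof -
  obtain s where s: "s \<in> Cauchy_Q" and q: "q = null_rel `` {s}"
    using assms unfolding Qbar_def by (auto elim: quotientE)
  have "\<forall>k. \<exists>N. \<forall>m\<ge>N. \<forall>n\<ge>N. s m - s n \<in> pow2Q k" using s unfolding Cauchy_Q_def by blast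
  then obtain N where N: "\<And>k m n. m \<ge> N k \<Longrightarrow> n \<ge> N k \<Longrightarrow> s m - s n \<in> pow2Q k" by metis
  \<comment> \<open>increasing indices beyond all moduli of convergence so far\<close>
  define M where "M k = (\<Sum>i\<le>k. N i) + k" for k
  have MN: "N k \<le> M l" if "k \<le> l" for k l
    unfolding M_def using that member_le_sum[of k "{..l}" N] by simp
  have Mk: "k \<le> M k" for k by (simp add: M_def)
  have sQ: "s n \<in> Q" for n using s unfolding Cauchy_Q_def by auto
  define v where "v k = (if k = 0 then 0 else s (M k))" for k
  have vQ: "v k \<in> Q" for k by (simp add: v_def sQ zero_in_Q)
  have step: "v m - v n \<in> pow2Q k" if "m \<ge> k" "n \<ge> k" "k > 0" for m n k
    using N[of k "M m" "M n"] MN that by (simp add: v_def)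
  have "v \<in> Cauchy_Q" unfolding Cauchy_Q_def
  proof (clarsimp simp: image_subset_iff vQ)
    fix k show "\<exists>N. \<forall>m\<ge>N. \<forall>n\<ge>N. v m - v n \<in> pow2Q k"
      by (rule exI[of _ "Suc k"]) (use step[of "Suc k"] pow2Q_antimono[of k "Suc k"] in auto)
  qed
  moreover have "\<exists>L. \<forall>n\<ge>L. s n - v n \<in> pow2Q k" for k
  proof (intro exI[of _ "Suc (M k)"] allI impI)
    fix n assume n: "Suc (M k) \<le> n"
    have "M k \<ge> N k" "k \<le> M k" by (simp_all add: MN Mk)
    then have "N k \<le> n" "N k \<le> M n" "n \<noteq> 0" using n MN[of k n] by linarith+
    then show "s n - v n \<in> pow2Q k" using N by (simp add: v_def)
  qed
  ultimately have "v \<in> q" unfolding q null_rel_def using s by auto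
  moreover have "v (Suc k) - v k \<in> pow2Q k" for k
  proof (cases "k = 0")
    case True then show ?thesis using Q_diff[OF vQ vQ] by (simp add: pow2Q_0)
  next
    case False then show ?thesis using step[of k "Suc k" k] by simp
  qed
  ultimately have "represents v q" unfolding represents_def by (simp add: v_def)
  then show thesis by (rule that)
qed

lemma represents_in_Q: 
  assumes "q \<in> Qbar" "represents v q" shows "v k \<in> Q"
proof -
  have "v \<in> Cauchy_Q" using assms unfolding Qbar_def represents_def null_rel_def by (auto elim!: quotientE)
  then show ?thesis unfolding Cauchy_Q_def by auto
qed

lemma represents_congruent:
  assumes "represents v q" "k \<le> l" shows "v l - v k \<in> pow2Q k"
  using assms(2)
proof (induction l rule: dec_induct)
  case base then show ?case by (simp add: zero_in_pow2Q)
next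
  case (step n)
  have "v (Suc n) - v n \<in> pow2Q k" using assms(1) step(1) pow2Q_antimono unfolding represents_def by blast
  from pow2Q_add[OF this step(3)] show ?case by simp
qed

lemma represents_unique:
  assumes "q \<in> Qbar" "represents v q" "represents u q" shows "v k - u k \<in> pow2Q k"
proof -
  obtain s where s: "s \<in> Cauchy_Q" and q: "q = null_rel `` {s}"
    using assms unfolding Qbar_def by (auto elim: quotientE)
  have "(s, v) \<in> null_rel" "(s, u) \<in> null_rel" using assms(2,3) q unfolding represents_def by auto
  then obtain N1 N2 where "\<forall>n\<ge>N1. s n - v n \<in> pow2Q k" "\<forall>n\<ge>N2. s n - u n \<in> pow2Q k"
    unfolding null_rel_def by fast
  define n where "n = N1 + N2 + k"
  have n: "s n - v n \<in> pow2Q k" "s n - u n \<in> pow2Q k"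
    using \<open>\<forall>n\<ge>N1. s n - v n \<in> pow2Q k\<close> \<open>\<forall>n\<ge>N2. s n - u n \<in> pow2Q k\<close> by (simp_all add: n_def)
  have "v n - v k \<in> pow2Q k" "u n - u k \<in> pow2Q k"
    using assms(2,3) by (simp_all add: represents_congruent n_def)
  then have "((s n - u n) - (s n - v n)) - ((v n - v k) - (u n - u k)) \<in> pow2Q k"
    using n by (meson pow2Q_diff)
  then show ?thesis by (simp add: algebra_simps)
qed

text \<open>Since later terms of a representing sequence agree with \<open>v k\<close> modulo \<open>pow2Q k\<close>, a single late term
  can serve as the origin for all smaller levels at once.\<close>

lemma level_vertices_eq:
  assumes "q \<in> Qbar" "represents v q" "k \<le> l"
  shows "y \<in> level_vertices q k \<longleftrightarrow> y - v l \<in> pow2Q k"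
proof
  assume "y \<in> level_vertices q k"
  then obtain u where u: "represents u q" "y - u k \<in> pow2Q k" unfolding level_vertices_def by blast
  have "(y - u k) - (v k - u k) - (v l - v k) \<in> pow2Q k"
    by (rule pow2Q_diff[OF pow2Q_diff[OF u(2) represents_unique[OF assms(1,2) u(1)]]
      represents_congruent[OF assms(2,3)]])
  then show "y - v l \<in> pow2Q k" by simp
next
  assume "y - v l \<in> pow2Q k"
  then have "(y - v l) + (v l - v k) \<in> pow2Q k"
    using assms by (intro pow2Q_add represents_congruent)
  then show "y \<in> level_vertices q k" unfolding level_vertices_def using assms(2) by auto
qed

lemma triple_add: 
  assumes "x \<in> Q" "y \<in> Q" shows "triple (x + y) j = triple x j + triple y j"
  using triple_diff[of "x + y" y j] assms by (simp add: Q_add)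

lemma frame_point_eqI:
  assumes "x \<in> Q" shows "x = frame_point j (- triple x (j + 1)) (triple x j)"
  using assms by (metis Q_frame triple_frame_point(1,2) minus_minus)

lemma a_unit_cnj: "a_unit j * cnj (a_unit j) = 1"
  using complex_norm_square[of "a_unit j"] by simp

lemma Im_frame_combination:
  "Im ((of_real p * a_unit j + of_real r * a_unit (j + 1)) * cnj (a_unit j)) = r * (sqrt 3 / 2)"
proof -
  have "(of_real p * a_unit j + of_real r * a_unit (j + 1)) * cnj (a_unit j)
      = (of_real p + of_real r * a2) * (a_unit j * cnj (a_unit j))"
    unfolding a_unit_add1 by (simp add: algebra_simps)
  then show ?thesis unfolding a_unit_cnj by (simp add: a2_def)
qed

lemma Im_frame_point: "Im (frame_point j m n * cnj (a_unit j)) = of_int n * (sqrt 3 / 2)"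
  using Im_frame_combination[of "of_int m" j "of_int n"] unfolding frame_point_def of_real_of_int_eq .

section \<open>Levels of lines as 2-adic divisibility\<close>

lemma line_through_a_unit_iff:
  "p \<in> line_through x (a_unit j) \<longleftrightarrow> Im ((p - x) * cnj (a_unit j)) = 0"
proof
  assume "p \<in> line_through x (a_unit j)"
  then obtain t where "p = x + of_real t * a_unit j" unfolding line_through_def by blast
  then have "(p - x) * cnj (a_unit j) = of_real t * (a_unit j * cnj (a_unit j))" by simp
  then show "Im ((p - x) * cnj (a_unit j)) = 0" by (simp add: a_unit_cnj)
next
  assume *: "Im ((p - x) * cnj (a_unit j)) = 0"
  define t where "t = Re ((p - x) * cnj (a_unit j))"
  have "of_real t = (p - x) * cnj (a_unit j)" using * by (simp add: t_def complex_eq_iff)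
  then have "of_real t * a_unit j = (p - x) * (a_unit j * cnj (a_unit j))" by simp
  then have "p = x + of_real t * a_unit j" by (simp add: a_unit_cnj)
  then show "p \<in> line_through x (a_unit j)" unfolding line_through_def by blast
qed

lemma lattice_point_on_line_iff:
  assumes "p \<in> Q" "x \<in> Q"
  shows "p \<in> line_through x (a_unit j) \<longleftrightarrow> triple p j = triple x j"
proof -
  obtain m n where "p - x = frame_point j m n" using Q_diff[OF assms] by (rule Q_frame)
  moreover from this have "triple p j - triple x j = n"
    using triple_diff[OF assms, of j] by (simp add: triple_frame_point)
  moreover have "sqrt 3 \<noteq> 0" by simp
  ultimately show ?thesis unfolding line_through_a_unit_iff by (simp only: Im_frame_point) auto
qed

lemma convex_line_through: "convex (line_through x d)"
proof (rule convexI)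
  fix a b :: complex and u w :: real
  assume "a \<in> line_through x d" "b \<in> line_through x d" and uw: "u + w = 1"
  then obtain s t where "a = x + of_real s * d" "b = x + of_real t * d"
    unfolding line_through_def by blast
  then have "u *\<^sub>R a + w *\<^sub>R b = of_real (u + w) * x + of_real (u * s + w * t) * d"
    by (simp add: scaleR_conv_of_real algebra_simps)
  then show "u *\<^sub>R a + w *\<^sub>R b \<in> line_through x d" unfolding line_through_def uw by (auto simp del: of_real_add of_real_mult)
qed

lemma line_through_scale:
  assumes "r \<noteq> 0" shows "line_through x (of_real r * d) = line_through x d"
proof (intro set_eqI iffI)
  fix p assume "p \<in> line_through x (of_real r * d)"
  then obtain t where "p = x + of_real t * (of_real r * d)" unfolding line_through_def by blast
  then have "p = x + of_real (t * r) * d" by simp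
  then show "p \<in> line_through x d" unfolding line_through_def by blast
next
  fix p assume "p \<in> line_through x d"
  then obtain t where "p = x + of_real t * d" unfolding line_through_def by blast
  then have "p = x + of_real (t / r) * (of_real r * d)" using assms by simp
  then show "p \<in> line_through x (of_real r * d)" unfolding line_through_def by blast
qed

lemma line_through_minus: "line_through x (- d) = line_through x d"
  using line_through_scale[of "-1" x d] by simp

lemma enat_le_SUP_iff: "enat (Suc s) \<le> (SUP k\<in>S. enat k) \<longleftrightarrow> (\<exists>k\<in>S. s < k)"
  by (auto simp: Suc_ile_eq less_SUP_iff)

lemma level_vertices_antimono:
  assumes "q \<in> Qbar" "represents v q" "k \<le> l" "y \<in> level_vertices q l"
  shows "y \<in> level_vertices q k"
proof -
  have "y - v l \<in> pow2Q l" using assms level_vertices_eq[of q v l l] by simp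
  then show ?thesis using assms level_vertices_eq[of q v k l] pow2Q_antimono by blast
qed

text \<open>A line of direction \<open>j\<close> is a level set of the \<open>j\<close>-th triple coordinate.  Relative to \<open>v k\<close> that
  coordinate is divisible by \<open>2 ^ s\<close> at all vertices of level \<open>s\<close>.  Conversely, every multiple of \<open>2 ^ s\<close> is
  attained at such vertices, which follow each other on the line at distance \<open>2 ^ s\<close>.\<close>

lemma a_level_ge_iff:
  assumes q: "q \<in> Qbar" "represents v q" and x: "x \<in> Q" and "s \<le> k"
  shows "enat s \<le> a_level q (line_through x (a_unit j)) \<longleftrightarrow> 2 ^ s dvd triple (x - v k) j"
proof
  have vQ: "v k \<in> Q" using q by (rule represents_in_Q)
  assume le: "enat s \<le> a_level q (line_through x (a_unit j))"
  show "2 ^ s dvd triple (x - v k) j"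
  proof (cases s)
    case (Suc s')
    then have "enat (Suc s') \<le> (SUP k\<in>{k. \<exists>e. level_edge q k e \<and> e \<subseteq> line_through x (a_unit j)}. enat k)"
      using le unfolding a_level_def by simp
    then obtain k' e where "s' < k'" "level_edge q k' e" "e \<subseteq> line_through x (a_unit j)"
      unfolding enat_le_SUP_iff by blast
    then have k': "s \<le> k'" "level_edge q k' e" "e \<subseteq> line_through x (a_unit j)"
      using Suc by simp_all
    then obtain A where A: "A \<in> level_vertices q k'" "A \<in> line_through x (a_unit j)"
      unfolding level_edge_def by auto
    have "A \<in> level_vertices q s" using level_vertices_antimono[OF q k'(1) A(1)] .
    then have A': "A - v k \<in> pow2Q s" using level_vertices_eq[OF q \<open>s \<le> k\<close>] by simp
    then have "A \<in> Q" using Q_add[OF pow2Q_sub_Q[OF A'] vQ] by simp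
    then have "triple (A - v k) j = triple (x - v k) j"
      using A(2) x vQ by (simp add: lattice_point_on_line_iff triple_diff)
    then show ?thesis using pow2Q_triple[OF A', of j] by simp
  qed simp
next
  have vQ: "v k \<in> Q" using q by (rule represents_in_Q)
  let ?n = "triple (x - v k) j"
  assume dvd: "2 ^ s dvd ?n"
  define A where "A = v k + frame_point j 0 ?n"
  define B where "B = A + frame_point j (2 ^ s) 0"
  have AQ: "A \<in> Q" "B \<in> Q" unfolding A_def B_def by (intro Q_add vQ frame_point_in_Q)+
  have "triple A j = triple x j" unfolding A_def
    using vQ x by (simp add: triple_add frame_point_in_Q triple_frame_point triple_diff)
  moreover have "triple B j = triple A j" unfolding B_def
    using AQ(1) by (simp add: triple_add frame_point_in_Q triple_frame_point)
  ultimately have "A \<in> line_through x (a_unit j)" "B \<in> line_through x (a_unit j)"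
    using x AQ by (simp_all add: lattice_point_on_line_iff)
  then have "closed_segment A B \<subseteq> line_through x (a_unit j)"
    by (simp add: closed_segment_subset convex_line_through)
  moreover have "A \<in> level_vertices q s" "B \<in> level_vertices q s"
    using dvd by (simp_all add: level_vertices_eq[OF q \<open>s \<le> k\<close>] A_def B_def pow2Q_frame_point
        frame_point_arith)
  moreover have "dist A B = 2 ^ s"
    by (simp add: B_def dist_norm frame_point_def norm_mult norm_power)
  ultimately have "level_edge q s (closed_segment A B)" "closed_segment A B \<subseteq> line_through x (a_unit j)"
    unfolding level_edge_def by blast+
  then show "enat s \<le> a_level q (line_through x (a_unit j))"
    unfolding a_level_def by (intro SUP_upper) auto
qed

text \<open>On the line perpendicular to direction \<open>j\<close> the difference of the other two triple coordinates is
  constant.  If it is divisible by \<open>2 ^ k\<close>, the line contains a level-\<open>k\<close> vertex, and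
  with it the centroid of a level-\<open>k\<close> triangle that has this vertex and is symmetric about the line.\<close>

lemma w_level_ge:
  assumes q: "q \<in> Qbar" "represents v q" and x: "x \<in> Q"
    and dvd: "2 ^ k dvd triple (x - v k) (j + 2) - triple (x - v k) (j + 1)"
  shows "enat k \<le> w_level q (line_through x (frame_point j 1 2))"
proof -
  have vQ: "v k \<in> Q" using q by (rule represents_in_Q)
  obtain m n where mn: "x - v k = frame_point j m n" using Q_diff[OF x vQ] by (rule Q_frame)
  define c where "c = 2 * m - n"
  have dvd': "2 ^ k dvd c" using dvd unfolding mn triple_frame_point c_def
    by (simp add: algebra_simps)
  define A where "A = v k + frame_point j 0 (- c)"
  define B where "B = v k + frame_point j (2 ^ k) (2 ^ k - c)"
  define C where "C = v k + frame_point j 0 (2 ^ k - c)"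
  have "A \<in> level_vertices q k" "B \<in> level_vertices q k" "C \<in> level_vertices q k"
    using dvd' by (simp_all add: level_vertices_eq[OF q order_refl] A_def B_def C_def pow2Q_frame_point)
  moreover have "A - B = 2 ^ k * a_unit (j + 2)" "B - C = 2 ^ k * a_unit j" "C - A = 2 ^ k * a_unit (j + 1)"
    unfolding a_unit_add2 by (simp_all add: A_def B_def C_def frame_point_def algebra_simps)
  then have "dist A B = 2 ^ k" "dist B C = 2 ^ k" "dist C A = 2 ^ k"
    unfolding dist_norm by (simp_all only: norm_mult norm_a_unit norm_power) simp_all
  ultimately have "level_triangle q k A B C" unfolding level_triangle_def by simp
  moreover have "centroid A B C \<in> line_through x (frame_point j 1 2)"
  proof -
    have "centroid A B C = x + of_real (2 ^ k / 3 - of_int m) * frame_point j 1 2"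
      using mn by (simp add: centroid_def A_def B_def C_def frame_point_def c_def field_simps)
    then show ?thesis unfolding line_through_def by blast
  qed
  ultimately show ?thesis unfolding w_level_def by (intro SUP_upper) auto
qed

lemma a_unit_cases:
  obtains "a_unit j = a1" "a_unit (j + 1) = a2" "a_unit (j + 2) = - (a1 + a2)"
  | "a_unit j = a2" "a_unit (j + 1) = - (a1 + a2)" "a_unit (j + 2) = a1"
  | "a_unit j = - (a1 + a2)" "a_unit (j + 1) = a1" "a_unit (j + 2) = a2"
proof -
  have "j mod 3 = 0 \<or> j mod 3 = 1 \<or> j mod 3 = 2" by presburger
  then show thesis
  proof (elim disjE)
    assume j: "j mod 3 = 0"
    then have "(j + 1) mod 3 = 1" "(j + 2) mod 3 = 2" by presburger+
    with j show thesis using that(3) a_unit_mod3 a_unit_0 a_unit_1 a_unit_2 by metis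
  next
    assume j: "j mod 3 = 1"
    then have "(j + 1) mod 3 = 2" "(j + 2) mod 3 = 0" by presburger+
    with j show thesis using that(1) a_unit_mod3 a_unit_0 a_unit_1 a_unit_2 by metis
  next
    assume j: "j mod 3 = 2"
    then have "(j + 1) mod 3 = 0" "(j + 2) mod 3 = 1" by presburger+
    with j show thesis using that(2) a_unit_mod3 a_unit_0 a_unit_1 a_unit_2 by metis
  qed
qed

lemma a_unit_line_in_a_lines:
  assumes "x \<in> Q" shows "line_through x (a_unit j) \<in> a_lines"
  by (cases rule: a_unit_cases[of j])
    (use assms in \<open>auto simp: a_lines_def a_dirs_def line_through_minus[of x "a1 + a2", simplified]\<close>)

lemma a_unit_line_in_w_lines:
  assumes "x \<in> Q" shows "line_through x (frame_point j 1 2) \<in> w_lines"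
proof -
  have "\<exists>d\<in>w_dirs. \<exists>r. r \<noteq> 0 \<and> frame_point j 1 2 = of_real r * d"
  proof (cases rule: a_unit_cases[of j])
    case 1
    then have "frame_point j 1 2 = of_real 3 * w2"
      by (simp only: frame_point_def) (simp add: w2_def)
    then show ?thesis unfolding w_dirs_def by (intro bexI[of _ w2] exI[of _ 3]) auto
  next
    case 2
    then have "frame_point j 1 2 = of_real (- 3) * w1"
      by (simp only: frame_point_def) (simp add: w1_def)
    then show ?thesis unfolding w_dirs_def by (intro bexI[of _ w1] exI[of _ "- 3"]) auto
  next
    case 3
    then have "frame_point j 1 2 = of_real (- 3) * (w2 - w1)"
      by (simp only: frame_point_def) (simp add: w1_def w2_def algebra_simps)
    then show ?thesis unfolding w_dirs_def by (intro bexI[of _ "w2 - w1"] exI[of _ "- 3"]) auto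
  qed
  then show ?thesis using assms unfolding w_lines_def using line_through_scale by fastforce
qed

text \<open>Divisibility of these coordinates by \<open>2 ^ k\<close> for arbitrarily large \<open>k\<close> would produce a line of
  infinite level.\<close>

lemma generic_eventually_not_dvd:
  assumes q: "q \<in> Qbar" "represents v q" "generic q" and x: "x \<in> Q"
  shows "\<forall>\<^sub>F k in sequentially. \<not> 2 ^ k dvd triple (x - v k) j"
    and "\<forall>\<^sub>F k in sequentially. \<not> 2 ^ k dvd triple (x - v k) (j + 2) - triple (x - v k) (j + 1)"
proof -
  have "a_level q (line_through x (a_unit j)) \<noteq> \<infinity>" "w_level q (line_through x (frame_point j 1 2)) \<noteq> \<infinity>"
    using q(3) a_unit_line_in_a_lines[OF x] a_unit_line_in_w_lines[OF x] unfolding generic_def by blast+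
  then obtain L L' where L: "a_level q (line_through x (a_unit j)) = enat L"
      "w_level q (line_through x (frame_point j 1 2)) = enat L'" by auto
  show "\<forall>\<^sub>F k in sequentially. \<not> 2 ^ k dvd triple (x - v k) j"
    using eventually_gt_at_top[of L]
  proof eventually_elim
    case (elim k) then show ?case using a_level_ge_iff[OF q(1,2) x, of k k j] L by simp
  qed
  show "\<forall>\<^sub>F k in sequentially. \<not> 2 ^ k dvd triple (x - v k) (j + 2) - triple (x - v k) (j + 1)"
    using eventually_gt_at_top[of L']
  proof eventually_elim
    case (elim k) then show ?case using w_level_ge[OF q(1,2) x, of k j] L by auto
  qed
qed

section \<open>Stripe directions\<close>

lemma triple_add3 [simp]: "triple x (j + 3) = triple x j"
  unfolding triple_def mod_add_self2 ..

lemma a_unit_or_minus_in_a_dirs: "a_unit j \<in> a_dirs \<or> - a_unit j \<in> a_dirs"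
  by (cases rule: a_unit_cases[of j]) (auto simp: a_dirs_def)

lemma a_dirs_a_unit:
  assumes "d \<in> a_dirs" obtains i where "i \<in> {j, j + 1, j + 2}" "d = a_unit i \<or> d = - a_unit i"
proof -
  have "\<exists>i\<in>{j, j + 1, j + 2}. d = a_unit i \<or> d = - a_unit i"
  proof (cases rule: a_unit_cases[of j])
    case 1
    then show ?thesis using assms unfolding a_dirs_def by (metis insert_iff empty_iff minus_minus)
  next
    case 2
    then show ?thesis using assms unfolding a_dirs_def by (metis insert_iff empty_iff minus_minus)
  next
    case 3
    then show ?thesis using assms unfolding a_dirs_def by (metis insert_iff empty_iff minus_minus)
  qed
  then show thesis using that by blast
qed

lemma a_unit_not_parallel:
  "a_unit (j + 1) \<notin> {a_unit j, - a_unit j}" "a_unit (j + 2) \<notin> {a_unit j, - a_unit j}"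
proof -
  have "a2 \<noteq> 1" "a2 \<noteq> - 1" "- 1 - a2 \<noteq> 1" "- 1 - a2 \<noteq> - 1" by (auto simp: a2_def complex_eq_iff)
  moreover have "a2 = c" if "a2 * a_unit j = c * a_unit j" for c using that by simp
  moreover have "a_unit (j + 2) = (- 1 - a2) * a_unit j" unfolding a_unit_add2 a_unit_add1 by (simp add: algebra_simps)
  moreover have "- 1 - a2 = c" if "(- 1 - a2) * a_unit j = c * a_unit j" for c 
    using that a_unit_nonzero mult_cancel_right by blast
  ultimately show "a_unit (j + 1) \<notin> {a_unit j, - a_unit j}" "a_unit (j + 2) \<notin> {a_unit j, - a_unit j}"
    unfolding a_unit_add1 by (metis insert_iff empty_iff mult_1 mult_minus1)+
qed

locale generic_tiling =
  fixes eps :: real and \<Lambda> :: "complex \<Rightarrow> tile" and q :: "(nat \<Rightarrow> complex) set"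
    and v :: "nat \<Rightarrow> complex"
  assumes eps: "0 < eps" "eps \<le> 1 / 4"
    and tiling: "\<Lambda> \<in> X_Q eps"
    and xi: "is_xi \<Lambda> q"
    and generic: "generic q"
    and v: "represents v q"
begin

lemma q_in_Qbar: "q \<in> Qbar" using xi unfolding is_xi_def by blast
lemmas q = q_in_Qbar v
lemma v_in_Q: "v k \<in> Q" using represents_in_Q[OF q] .

lemma tile: "x \<in> Q \<Longrightarrow> is_tile (\<Lambda> x)"
  using tiling unfolding X_Q_def by blast

lemma a_level_finite: "x \<in> Q \<Longrightarrow> a_level q (line_through x (a_unit j)) \<noteq> \<infinity>"
  using generic a_unit_line_in_a_lines unfolding generic_def by blast

lemma xi_at:
  assumes "x \<in> Q"
  shows "\<And>d. d \<in> a_dirs - {stripe_dir (\<Lambda> x)} \<Longrightarrow>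
      a_level q (line_through x d) < a_level q (line_through x (stripe_dir (\<Lambda> x)))"
    and "\<And>k. a_level q (line_through x (stripe_dir (\<Lambda> x))) = enat k \<Longrightarrow>
           (\<exists>A B C. level_triangle q (Suc k) A B C \<and>
              level_edge q k (closed_segment (midpoint A B) (midpoint A C)) \<and>
              x \<in> closed_segment (midpoint A B) (midpoint A C) \<and>
              stripe_side (\<Lambda> x) \<bullet> (centroid A B C - x) > 0)"
proof -
  have "line_through x a1 \<in> a_lines" using assms unfolding a_lines_def a_dirs_def by blast
  then have "a_level q (line_through x a1) \<noteq> \<infinity>" using generic unfolding generic_def by blast
  then have "\<exists>d\<in>a_dirs. a_level q (line_through x d) \<noteq> \<infinity>" unfolding a_dirs_def by blast
  then have *: "(\<forall>d\<in>a_dirs - {stripe_dir (\<Lambda> x)}.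
           a_level q (line_through x d) < a_level q (line_through x (stripe_dir (\<Lambda> x)))) \<and>
        (\<forall>k. a_level q (line_through x (stripe_dir (\<Lambda> x))) = enat k \<longrightarrow>
           (\<exists>A B C. level_triangle q (Suc k) A B C \<and>
              level_edge q k (closed_segment (midpoint A B) (midpoint A C)) \<and>
              x \<in> closed_segment (midpoint A B) (midpoint A C) \<and>
              stripe_side (\<Lambda> x) \<bullet> (centroid A B C - x) > 0))"
    using xi assms unfolding is_xi_def by blast
  show "\<And>d. d \<in> a_dirs - {stripe_dir (\<Lambda> x)} \<Longrightarrow>
      a_level q (line_through x d) < a_level q (line_through x (stripe_dir (\<Lambda> x)))"
    using * by blast
  show "\<And>k. a_level q (line_through x (stripe_dir (\<Lambda> x))) = enat k \<Longrightarrow>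
           (\<exists>A B C. level_triangle q (Suc k) A B C \<and>
              level_edge q k (closed_segment (midpoint A B) (midpoint A C)) \<and>
              x \<in> closed_segment (midpoint A B) (midpoint A C) \<and>
              stripe_side (\<Lambda> x) \<bullet> (centroid A B C - x) > 0)"
    using * by blast
qed

lemma stripe_level_greatest:
  assumes x: "x \<in> Q" and st: "stripe_dir (\<Lambda> x) \<in> {a_unit j, - a_unit j}"
    and "a_unit i \<notin> {a_unit j, - a_unit j}"
  shows "a_level q (line_through x (a_unit i)) < a_level q (line_through x (a_unit j))"
proof -
  obtain d where d: "d \<in> a_dirs" "d = a_unit i \<or> d = - a_unit i"
    using a_unit_or_minus_in_a_dirs by blast
  have "d \<noteq> stripe_dir (\<Lambda> x)" using d(2) st assms(3) by auto
  then have "a_level q (line_through x d) < a_level q (line_through x (stripe_dir (\<Lambda> x)))"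
    using xi_at(1)[OF x] d(1) by blast
  moreover have "line_through x d = line_through x (a_unit i)"
    using d(2) by (auto simp: line_through_minus)
  moreover have "line_through x (stripe_dir (\<Lambda> x)) = line_through x (a_unit j)"
    using st by (auto simp: line_through_minus)
  ultimately show ?thesis by simp
qed

text \<open>Only one of the three lines through \<open>x\<close> can have a level above the two others.  Since the three
  coordinates add up to 0, a power of 2 that divides the \<open>j\<close>-th but not the next one does not divide the
  third one either, and so it separates line \<open>j\<close> from the others.  The condition is about a single power
  \<open>2 ^ s\<close> with \<open>s \<le> k\<close>, so that one \<open>k\<close> serves all tiles of a w-line, whatever their levels.\<close>

lemma stripe_dir_eqI:
  assumes x: "x \<in> Q" and "s \<le> k" and j: "2 ^ s dvd triple (x - v k) j"
    and j1: "\<not> 2 ^ s dvd triple (x - v k) (j + 1)"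
  shows "stripe_dir (\<Lambda> x) \<in> {a_unit j, - a_unit j}"
proof (rule ccontr)
  assume no: "stripe_dir (\<Lambda> x) \<notin> {a_unit j, - a_unit j}"
  have xQ: "x - v k \<in> Q" by (rule Q_diff[OF x v_in_Q])
  have "triple (x - v k) (j + 2) = - triple (x - v k) j - triple (x - v k) (j + 1)"
    using triple_sum[OF xQ, of j] by linarith
  then have j2: "\<not> 2 ^ s dvd triple (x - v k) (j + 2)"
    using j j1 by (metis dvd_diff_right_iff dvd_minus_iff)
  have "stripe_dir (\<Lambda> x) \<in> a_dirs" using tile[OF x] unfolding is_tile_def by blast
  then obtain i where i: "i \<in> {j, j + 1, j + 2}" "stripe_dir (\<Lambda> x) = a_unit i \<or> stripe_dir (\<Lambda> x) = - a_unit i"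
    by (rule a_dirs_a_unit)
  then have ij: "i = j + 1 \<or> i = j + 2" using no by auto
  then have "\<not> 2 ^ s dvd triple (x - v k) i" using j1 j2 by auto
  then have "\<not> enat s \<le> a_level q (line_through x (a_unit i))"
    using a_level_ge_iff[OF q x \<open>s \<le> k\<close>] by simp
  moreover have "enat s \<le> a_level q (line_through x (a_unit j))"
    using a_level_ge_iff[OF q x \<open>s \<le> k\<close>] j by simp
  moreover have "a_level q (line_through x (a_unit j)) < a_level q (line_through x (a_unit i))"
    using i(2) by (intro stripe_level_greatest[OF x]) (use ij a_unit_not_parallel[of j] in auto)
  ultimately show False by (meson le_less_trans less_imp_le not_le)
qed

end

section \<open>The side of the stripe\<close>

lemma unit_norm_form:
  fixes m n :: int
  assumes "m\<^sup>2 - m * n + n\<^sup>2 = 1"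
  shows "(m, n) \<in> {(1, 0), (-1, 0), (0, 1), (0, -1), (1, 1), (-1, -1)}"
proof -
  have bound: "k \<in> {-1, 0, 1}" if "(2 * h - k)\<^sup>2 + 3 * k\<^sup>2 = 4" for h k :: int
  proof -
    have "3 * k\<^sup>2 \<le> 4" using that zero_le_power2[of "2 * h - k"] by linarith
    then have "k\<^sup>2 \<le> 1" by linarith
    then have "\<bar>k\<bar> \<le> 1" by (simp add: abs_square_le_1)
    then show ?thesis by auto
  qed
  have "n \<in> {-1, 0, 1}"
    by (rule bound[of m]) (use assms in \<open>simp add: power2_eq_square algebra_simps\<close>)
  moreover have "m \<in> {-1, 0, 1}"
    by (rule bound[of n]) (use assms in \<open>simp add: power2_eq_square algebra_simps\<close>)
  ultimately show ?thesis using assms by auto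
qed

lemma norm_frame_point: "(cmod (frame_point j m n))\<^sup>2 = real_of_int (m\<^sup>2 - m * n + n\<^sup>2)"
proof -
  have "frame_point j m n = (of_int m + of_int n * a2) * a_unit j"
    unfolding frame_point_def a_unit_add1 by (simp add: algebra_simps)
  then have "(cmod (frame_point j m n))\<^sup>2 = (cmod (of_int m + of_int n * a2))\<^sup>2"
    by (simp add: norm_mult)
  also have "\<dots> = (of_int m - of_int n / 2)\<^sup>2 + 3 / 4 * (of_int n)\<^sup>2"
    by (simp add: cmod_power2 a2_def power_mult_distrib power_divide)
  finally show ?thesis by (simp add: power2_eq_square field_simps)
qed

lemma frame_independent:
  assumes "of_real a * a_unit j + of_real b * a_unit (j + 1) = of_real a' * a_unit j + of_real b' * a_unit (j + 1)"
  shows "a = a'" "b = b'"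
proof -
  have "(of_real a + of_real b * a2) * a_unit j = (of_real a' + of_real b' * a2) * a_unit j"
    using assms unfolding a_unit_add1 by (simp add: algebra_simps)
  then have "of_real a + of_real b * a2 = of_real a' + of_real b' * a2" by simp
  then show "a = a'" "b = b'" by (simp_all add: complex_eq_iff a2_def)
qed

text \<open>In units of \<open>2 ^ l\<close>, this is about a triangle with vertices \<open>(2 * \<alpha>, 2 * \<beta>)\<close>,
  \<open>(2 * (\<alpha> + m), 2 * (\<beta> + n))\<close> and \<open>(2 * (\<alpha> + m'), 2 * (\<beta> + n'))\<close>, and a point
  \<open>(M / 2 ^ l, N / 2 ^ l)\<close> on the midsegment adjacent to the first vertex.  Because \<open>M\<close> is not a multiple of \<open>2 ^ l\<close>, the point
  is interior to the midsegment; because \<open>N\<close> is one, the midsegment is parallel to the first basis vector.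
  The cases \<open>n = 1\<close> and \<open>n = - 1\<close> are those where the first vertex lies below and above the
  midsegment; the opposite side of the triangle, and with it the centroid, is on the other side.\<close>

lemma midsegment_arith:
  fixes m n m' n' \<alpha> \<beta> M N :: int and t :: real
  assumes B: "m\<^sup>2 - m * n + n\<^sup>2 = 1" and C: "m'\<^sup>2 - m' * n' + n'\<^sup>2 = 1"
    and BC: "(m - m')\<^sup>2 - (m - m') * (n - n') + (n - n')\<^sup>2 = 1"
    and t: "0 \<le> t" "t \<le> 1"
    and M: "real_of_int M = 2 ^ l * (2 * \<alpha> + (1 - t) * m + t * m')"
    and N: "real_of_int N = 2 ^ l * (2 * \<beta> + (1 - t) * n + t * n')"
    and dvd: "2 ^ l dvd N" "\<not> 2 ^ (l + 1) dvd N" "\<not> 2 ^ l dvd M"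
  shows "n' = n \<and> (n = 1 \<and> even (M div 2 ^ l) \<or> n = - 1 \<and> odd (M div 2 ^ l))"
proof -
  obtain N' where N': "N = 2 ^ l * N'" using dvd(1) by (auto simp: dvd_def)
  have oddN: "odd N'" using dvd(2) unfolding N' by (auto simp: mult.commute)
  have no_int: "2 * \<alpha> + (1 - t) * m + t * m' \<noteq> of_int i" for i :: int
  proof
    assume "2 * \<alpha> + (1 - t) * m + t * m' = of_int i"
    then have "real_of_int M = of_int (2 ^ l * i)" using M by simp
    then have "M = 2 ^ l * i" by linarith
    then show False using dvd(3) by simp
  qed
  have t01: "t \<noteq> 0" "t \<noteq> 1" using no_int[of "2 * \<alpha> + m"] no_int[of "2 * \<alpha> + m'"] by auto
  have "real_of_int N = 2 ^ l * of_int N'" by (simp add: N')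
  then have N'_eq: "of_int N' = 2 * \<beta> + (1 - t) * n + t * n'" using N by simp
  have mn: "(m, n) \<in> {(1, 0), (-1, 0), (0, 1), (0, -1), (1, 1), (-1, -1)}"
     "(m', n') \<in> {(1, 0), (-1, 0), (0, 1), (0, -1), (1, 1), (-1, -1)}"
     "(m - m', n - n') \<in> {(1, 0), (-1, 0), (0, 1), (0, -1), (1, 1), (-1, -1)}"
    using B C BC by (intro unit_norm_form; simp)+
  have eqn: "n' = n"
  proof (rule ccontr)
    assume "n' \<noteq> n"
    then have "n' - n = 1 \<or> n' - n = - 1" using mn(3) by auto
    then have "t = of_int (N' - 2 * \<beta> - n) \<or> t = of_int (2 * \<beta> + n - N')"
      using N'_eq by (auto simp: algebra_simps)
    then obtain i :: int where "t = of_int i" by blast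
    then have "i = 0 \<or> i = 1" using t by auto
    then show False using \<open>t = of_int i\<close> t01 by auto
  qed
  have "real_of_int N' = of_int (2 * \<beta> + n)" using N'_eq eqn by (simp add: algebra_simps)
  then have "odd n" using oddN by (metis even_add even_mult_iff even_numeral of_int_eq_iff)
  define u where "u = (1 - t) * m + t * m'"
  have Mu: "real_of_int M = 2 ^ l * (2 * \<alpha> + u)" using M by (simp add: u_def)
  have floor: "M div 2 ^ l = 2 * \<alpha> + i" if "i \<le> u" "u < i + 1" for i :: int
  proof -
    have "M div 2 ^ l = \<lfloor>real_of_int M / real_of_int (2 ^ l)\<rfloor>" by (rule floor_divide_of_int_eq[symmetric])
    also have "\<dots> = \<lfloor>2 * \<alpha> + u\<rfloor>" using Mu by simp
    also have "\<dots> = 2 * \<alpha> + i" using that by (intro floor_unique) auto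
    finally show ?thesis .
  qed
  from \<open>odd n\<close> mn(1) consider "n = 1" | "n = - 1" by auto
  then show ?thesis
  proof cases
    case 1
    then have "m = 0 \<and> m' = 1 \<or> m = 1 \<and> m' = 0" using mn eqn by auto
    then have "0 \<le> u" "u < 1" using t t01 by (auto simp: u_def)
    then show ?thesis using 1 eqn floor[of 0] by simp
  next
    case 2
    then have "m = 0 \<and> m' = - 1 \<or> m = - 1 \<and> m' = 0" using mn eqn by auto
    then have "- 1 \<le> u" "u < 0" using t t01 by (auto simp: u_def)
    then show ?thesis using 2 eqn floor[of "- 1"] by simp
  qed
qed

lemma inner_i_a_unit: "(\<i> * a_unit j) \<bullet> y = Im (y * cnj (a_unit j))"
  by (simp add: inner_complex_def algebra_simps)

context generic_tiling begin

text \<open>The midsegment containing \<open>x\<close> has integral ends in units of \<open>2 ^ l\<close>, and its left end is even exactly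
  for the triangles with their centroid above it.\<close>

lemma stripe_side_iff:
  assumes x: "x \<in> Q" and st: "stripe_dir (\<Lambda> x) \<in> {a_unit j, - a_unit j}"
    and level: "a_level q (line_through x (a_unit j)) = enat l" and lk: "l < k"
  shows "stripe_side (\<Lambda> x) = \<i> * a_unit j \<longleftrightarrow> even (- triple (x - v k) (j + 1) div 2 ^ l)"
proof -
  define M N where "M = - triple (x - v k) (j + 1)" and "N = triple (x - v k) j"
  have xQ: "x - v k \<in> Q" by (rule Q_diff[OF x v_in_Q])
  have xMN: "x - v k = frame_point j M N" unfolding M_def N_def using xQ by (rule frame_point_eqI)
  have dvdN: "2 ^ l dvd N" "\<not> 2 ^ (l + 1) dvd N"
    using a_level_ge_iff[OF q x, of l k j] a_level_ge_iff[OF q x, of "l + 1" k j] lk level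
    by (simp_all add: N_def)
  have "a_level q (line_through x (a_unit (j + 1))) < enat l"
    using stripe_level_greatest[OF x st a_unit_not_parallel(1)] level by simp
  then have dvdM: "\<not> 2 ^ l dvd M"
    using a_level_ge_iff[OF q x, of l k "j + 1"] lk by (auto simp: M_def)
  have "line_through x (stripe_dir (\<Lambda> x)) = line_through x (a_unit j)"
    using st by (auto simp: line_through_minus)
  then obtain A B C where tri: "level_triangle q (Suc l) A B C"
    and xAB: "x \<in> closed_segment (midpoint A B) (midpoint A C)"
    and inner: "stripe_side (\<Lambda> x) \<bullet> (centroid A B C - x) > 0"
    using xi_at(2)[OF x, of l] level by auto
  have vert: "\<exists>a b. y - v k = 2 * 2 ^ l * frame_point j a b" if "y \<in> level_vertices q (Suc l)" for y
  proof -
    have "y - v k \<in> pow2Q (Suc l)" using that level_vertices_eq[OF q, of "Suc l" k] lk by simp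
    then obtain y' where y': "y' \<in> Q" "y - v k = 2 * 2 ^ l * y'" unfolding pow2Q_def by auto
    obtain a b where "y' = frame_point j a b" using y'(1) by (rule Q_frame)
    then show ?thesis using y'(2) by blast
  qed
  obtain \<alpha> \<beta> where A: "A - v k = 2 * 2 ^ l * frame_point j \<alpha> \<beta>"
    using tri vert unfolding level_triangle_def by blast
  obtain b b' where B: "B - v k = 2 * 2 ^ l * frame_point j b b'"
    using tri vert unfolding level_triangle_def by blast
  obtain c c' where C: "C - v k = 2 * 2 ^ l * frame_point j c c'"
    using tri vert unfolding level_triangle_def by blast
  define m n m' n' where "m = b - \<alpha>" "n = b' - \<beta>" "m' = c - \<alpha>" "n' = c' - \<beta>"
  note defs = this
  have unit: "h\<^sup>2 - h * i + i\<^sup>2 = 1"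
    if "Y - Z = 2 * 2 ^ l * frame_point j h i" "dist Y Z = 2 ^ Suc l" for Y Z h i
  proof -
    have "cmod (frame_point j h i) = 1" using that by (simp add: dist_norm norm_mult norm_power)
    then have "real_of_int (h\<^sup>2 - h * i + i\<^sup>2) = 1"
      using norm_frame_point[of j h i] by simp
    then show ?thesis by linarith
  qed
  have BA: "B - A = 2 * 2 ^ l * frame_point j m n"
  proof -
    have "B - A = (B - v k) - (A - v k)" by simp
    then show ?thesis unfolding A B defs by (simp flip: right_diff_distrib add: frame_point_arith)
  qed
  have CA: "C - A = 2 * 2 ^ l * frame_point j m' n'"
  proof -
    have "C - A = (C - v k) - (A - v k)" by simp
    then show ?thesis unfolding A C defs by (simp flip: right_diff_distrib add: frame_point_arith)
  qed
  have BC: "B - C = 2 * 2 ^ l * frame_point j (m - m') (n - n')"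
  proof -
    have "B - C = (B - A) - (C - A)" by simp
    then show ?thesis unfolding BA CA by (simp flip: right_diff_distrib add: frame_point_arith)
  qed
  obtain t where t: "0 \<le> t" "t \<le> 1" "x = (1 - t) *\<^sub>R midpoint A B + t *\<^sub>R midpoint A C"
    using xAB unfolding closed_segment_def by blast
  have halves: "(B - A) / 2 = 2 ^ l * frame_point j m n" "(C - A) / 2 = 2 ^ l * frame_point j m' n'"
    unfolding BA CA by simp_all
  have "x - v k = (A - v k) + of_real (1 - t) * ((B - A) / 2) + of_real t * ((C - A) / 2)"
    unfolding t(3) by (simp add: midpoint_def scaleR_conv_of_real field_simps)
  then have "frame_point j M N =
      of_real (2 ^ l * (2 * \<alpha> + (1 - t) * m + t * m')) * a_unit j +
      of_real (2 ^ l * (2 * \<beta> + (1 - t) * n + t * n')) * a_unit (j + 1)"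
    unfolding xMN A halves frame_point_def by (simp add: algebra_simps)
  then have "of_real (of_int M) * a_unit j + of_real (of_int N) * a_unit (j + 1) =
      of_real (2 ^ l * (2 * \<alpha> + (1 - t) * m + t * m')) * a_unit j +
      of_real (2 ^ l * (2 * \<beta> + (1 - t) * n + t * n')) * a_unit (j + 1)"
    unfolding frame_point_def by simp
  note MN = frame_independent[OF this]
  have dist: "dist B A = 2 ^ Suc l" "dist C A = 2 ^ Suc l" "dist B C = 2 ^ Suc l"
    using tri unfolding level_triangle_def by (simp_all add: dist_commute)
  \<comment> \<open>the midsegment is parallel to the stripe, so the sign of \<open>n\<close> tells on which side of it the centroid lies\<close>
  have key: "n' = n \<and> (n = 1 \<and> even (M div 2 ^ l) \<or> n = - 1 \<and> odd (M div 2 ^ l))"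
    by (rule midsegment_arith[OF unit[OF BA dist(1)] unit[OF CA dist(2)] unit[OF BC dist(3)]
        t(1,2) MN dvdN dvdM])
  have "centroid A B C - x = (A - v k) + (B - A) / 3 + (C - A) / 3 - (x - v k)"
    by (simp add: centroid_def field_simps)
  also have "\<dots> = of_real (2 * 2 ^ l * (\<alpha> + m / 3 + m' / 3) - M) * a_unit j
      + of_real (2 * 2 ^ l * (\<beta> + n / 3 + n' / 3) - N) * a_unit (j + 1)"
    unfolding xMN A BA CA frame_point_def by (simp add: field_simps)
  also have "2 * 2 ^ l * (\<beta> + n / 3 + n' / 3) - N = 2 ^ l * n / 3"
    unfolding MN using key by (simp add: field_simps)
  finally have "centroid A B C - x = of_real (2 * 2 ^ l * (\<alpha> + m / 3 + m' / 3) - M) * a_unit j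
      + of_real (2 ^ l * n / 3) * a_unit (j + 1)" .
  then have im: "(\<i> * a_unit j) \<bullet> (centroid A B C - x) = 2 ^ l * n / 3 * (sqrt 3 / 2)"
    unfolding inner_i_a_unit by (simp only: Im_frame_combination)
  have "stripe_side (\<Lambda> x) \<in> {\<i> * a_unit j, - (\<i> * a_unit j)}"
    using tile[OF x] st unfolding is_tile_def by auto
  moreover have "stripe_side (\<Lambda> x) \<noteq> - (\<i> * a_unit j)" if "n = 1"
  proof
    assume "stripe_side (\<Lambda> x) = - (\<i> * a_unit j)"
    with inner have "(\<i> * a_unit j) \<bullet> (centroid A B C - x) < 0" by simp
    then show False unfolding im using that by (simp add: mult_less_0_iff)
  qed
  moreover have "stripe_side (\<Lambda> x) \<noteq> \<i> * a_unit j" if "n = - 1"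
  proof
    assume "stripe_side (\<Lambda> x) = \<i> * a_unit j"
    with inner have "(\<i> * a_unit j) \<bullet> (centroid A B C - x) > 0" by simp
    moreover have "2 ^ l * sqrt 3 > 0" by simp
    ultimately show False unfolding im using that by simp
  qed
  ultimately show ?thesis using key unfolding M_def by auto
qed
end

section \<open>Colours along a w-line\<close>

lemma vertex_in_half_diagonal_iff:
  assumes "cmod u = 1" "cmod w = 1"
  shows "x + u / of_real (sqrt 3) \<in> half_diagonal x w \<longleftrightarrow> u = w"
proof
  assume "x + u / of_real (sqrt 3) \<in> half_diagonal x w"
  then obtain t where t: "0 \<le> t" "x + u / of_real (sqrt 3) =
      (1 - t) *\<^sub>R x + t *\<^sub>R (x + w / of_real (sqrt 3))"
    unfolding half_diagonal_def closed_segment_def by blast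
  then have "u = of_real t * w" by (simp add: scaleR_conv_of_real field_simps)
  moreover from this have "cmod u = t" using t(1) assms(2) by (simp add: norm_mult)
  ultimately show "u = w" using assms(1) by simp
qed (simp add: half_diagonal_def)

lemma vertex_in_red_iff:
  assumes "is_tile t" "cmod u = 1"
  shows "x + u / of_real (sqrt 3) \<in> red x t \<longleftrightarrow>
    u \<in> {cis (- pi / 6) * stripe_dir t, - (cis (- pi / 6) * stripe_dir t), red_side t}"
proof -
  obtain i where "stripe_dir t = a_unit i \<or> stripe_dir t = - a_unit i"
    using assms(1) unfolding is_tile_def by (auto elim: a_dirs_a_unit)
  then have "cmod (stripe_dir t) = 1" by auto
  moreover from this have "cmod (red_side t) = 1"
    using assms(1) unfolding is_tile_def by (auto simp: norm_mult)
  ultimately show ?thesis unfolding red_def diagonal_def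
    using assms(2) by (auto simp: vertex_in_half_diagonal_iff norm_mult)
qed

lemma vertex_in_blue_iff:
  assumes "is_tile t" "cmod u = 1"
  shows "x + u / of_real (sqrt 3) \<in> blue x t \<longleftrightarrow>
    u \<in> {cis (pi / 6) * stripe_dir t, - (cis (pi / 6) * stripe_dir t), - red_side t}"
proof -
  obtain i where "stripe_dir t = a_unit i \<or> stripe_dir t = - a_unit i"
    using assms(1) unfolding is_tile_def by (auto elim: a_dirs_a_unit)
  then have "cmod (stripe_dir t) = 1" by auto
  moreover from this have "cmod (red_side t) = 1"
    using assms(1) unfolding is_tile_def by (auto simp: norm_mult)
  ultimately show ?thesis unfolding blue_def diagonal_def
    using assms(2) by (auto simp: vertex_in_half_diagonal_iff norm_mult)
qed

lemma cis_30: "cis (pi / 6) = Complex (sqrt 3 / 2) (1 / 2)"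
    "cis (- pi / 6) = Complex (sqrt 3 / 2) (- 1 / 2)"
  by (simp_all add: complex_eq_iff cos_30 sin_30)

text \<open>If the stripe has direction \<open>j\<close>, the diagonal perpendicular to it is the split one, and the colours at
  its two ends are opposite, so each of them tells the side of the red half.  With one of the other two
  stripe directions that diagonal is entirely red (\<open>j + 1\<close>) or entirely blue (\<open>j + 2\<close>).\<close>

lemma vertex_colours:
  assumes "is_tile t"
  shows "stripe_dir t \<in> {a_unit j, - a_unit j} \<Longrightarrow>
      x + \<i> * a_unit j / of_real (sqrt 3) \<in> red x t \<longleftrightarrow> red_side t = \<i> * a_unit j"
    and "stripe_dir t \<in> {a_unit j, - a_unit j} \<Longrightarrow>
      x - \<i> * a_unit j / of_real (sqrt 3) \<in> blue x t \<longleftrightarrow> red_side t = \<i> * a_unit j"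
    and "stripe_dir t \<in> {a_unit (j + 1), - a_unit (j + 1)} \<Longrightarrow>
      x - \<i> * a_unit j / of_real (sqrt 3) \<notin> blue x t"
    and "stripe_dir t \<in> {a_unit (j + 2), - a_unit (j + 2)} \<Longrightarrow>
      x - \<i> * a_unit j / of_real (sqrt 3) \<in> blue x t"
proof -
  define e where "e = a_unit j"
  have e: "e \<noteq> 0" by (simp add: e_def)
  have cancel: "a * e = b * e \<longleftrightarrow> a = b" for a b using e by simp
  have ax: "a_unit (j + 1) = a2 * e" "a_unit (j + 2) = (- 1 - a2) * e"
    unfolding a_unit_add2 a_unit_add1 e_def by (simp_all add: algebra_simps)
  have side: "red_side t \<in> {\<i> * stripe_dir t, - (\<i> * stripe_dir t)}"
    using assms unfolding is_tile_def by blast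
  have u: "cmod (\<i> * e) = 1" "cmod (- (\<i> * e)) = 1" by (simp_all add: e_def norm_mult)
  have minus: "x - \<i> * e / of_real (sqrt 3) = x + (- (\<i> * e)) / of_real (sqrt 3)" by simp
  have cis_neq: "\<i> \<noteq> cis (pi / 6)" "\<i> \<noteq> - cis (pi / 6)" "\<i> \<noteq> cis (- pi / 6)" "\<i> \<noteq> - cis (- pi / 6)"
    unfolding cis_30 by (simp_all add: complex_eq_iff)
  have neq: "\<i> * e \<noteq> c * e" "- (\<i> * e) \<noteq> - (c * e)" if "\<i> \<noteq> c" for c
    using that cancel neg_equal_iff_equal by blast+
  show "x + \<i> * a_unit j / of_real (sqrt 3) \<in> red x t \<longleftrightarrow> red_side t = \<i> * a_unit j"
    if "stripe_dir t \<in> {a_unit j, - a_unit j}"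
    unfolding e_def[symmetric] vertex_in_red_iff[OF assms u(1)]
    using that neq[OF cis_neq(3)] neq[OF cis_neq(4)] unfolding e_def[symmetric] by auto
  show "x - \<i> * a_unit j / of_real (sqrt 3) \<in> blue x t \<longleftrightarrow> red_side t = \<i> * a_unit j"
    if "stripe_dir t \<in> {a_unit j, - a_unit j}"
    unfolding e_def[symmetric] minus vertex_in_blue_iff[OF assms u(2)]
    using that neq[OF cis_neq(1)] neq[OF cis_neq(2)] unfolding e_def[symmetric] by auto
  show "x - \<i> * a_unit j / of_real (sqrt 3) \<notin> blue x t"
    if "stripe_dir t \<in> {a_unit (j + 1), - a_unit (j + 1)}"
  proof -
    have a: "\<i> \<noteq> cis (pi / 6) * a2" "\<i> \<noteq> - cis (pi / 6) * a2" "\<i> \<noteq> \<i> * a2" "\<i> \<noteq> - \<i> * a2"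
      unfolding cis_30 by (simp_all add: complex_eq_iff a2_def)
    show ?thesis
      unfolding e_def[symmetric] minus vertex_in_blue_iff[OF assms u(2)]
      using that side neq[OF a(1)] neq[OF a(2)] neq[OF a(3)] neq[OF a(4)] unfolding ax
      by (auto simp: mult.assoc)
  qed
  show "x - \<i> * a_unit j / of_real (sqrt 3) \<in> blue x t"
    if "stripe_dir t \<in> {a_unit (j + 2), - a_unit (j + 2)}"
  proof -
    have "- \<i> = cis (pi / 6) * (- 1 - a2)"
      unfolding cis_30 by (simp add: complex_eq_iff a2_def)
    then have "- (\<i> * e) = cis (pi / 6) * ((- 1 - a2) * e)" by (metis mult.assoc mult_minus_left)
    then show ?thesis
      unfolding e_def[symmetric] minus vertex_in_blue_iff[OF assms u(2)]
      using that unfolding ax by auto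
  qed
qed

lemma frame_point_12: "frame_point j 1 2 = 3 * (\<i> * a_unit j / of_real (sqrt 3))"
proof -
  have "1 + 2 * a2 = 3 * (\<i> / of_real (sqrt 3))"
    by (simp add: complex_eq_iff a2_def field_simps)
  then have "(1 + 2 * a2) * a_unit j = 3 * (\<i> / of_real (sqrt 3)) * a_unit j" by simp
  then show ?thesis by (simp add: frame_point_def a_unit_add1[simplified] algebra_simps)
qed

lemma vertex_in_Omega: "\<i> * a_unit j / of_real (sqrt 3) \<in> Omega"
proof -
  have *: "\<i> * a_unit j / of_real (sqrt 3) = (a_unit j + 2 * a_unit (j + 1)) / 3"
    using frame_point_12[of j] by (simp add: frame_point_def)
  show ?thesis unfolding * Omega_def
    by (cases rule: a_unit_cases[of j])
      (simp_all only:, simp_all add: w1_def w2_def field_simps)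
qed

section \<open>The first change of the stripe direction on a w-line\<close>

lemma exact_power_of_two:
  fixes z :: int
  assumes "\<not> 2 ^ k dvd z"
  obtains r where "2 ^ r dvd z" "\<not> 2 ^ Suc r dvd z" "r < k"
proof -
  have "z \<noteq> 0" using assms by auto
  then have r: "2 ^ multiplicity 2 z dvd z" "\<not> 2 ^ Suc (multiplicity 2 z) dvd z"
    by (simp_all add: multiplicity_dvd power_dvd_iff_le_multiplicity del: power_Suc)
  have "multiplicity 2 z < k"
  proof (rule ccontr)
    assume "\<not> multiplicity 2 z < k"
    then show False using assms r(1) by (meson dvd_trans le_imp_power_dvd not_less)
  qed
  with r show thesis by (rule that)
qed

text \<open>In this lemma and the next one, \<open>c - 2 * a\<close>, \<open>a - c\<close> and \<open>a\<close> are the triple coordinates \<open>j\<close>, \<open>j + 1\<close>, \<open>j + 2\<close>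
  of a point on a w-line on which \<open>c\<close> is constant.  Together they say that the \<open>j\<close>-th coordinate
  has the largest power of 2 exactly at the points where \<open>a\<close> has a smaller power of 2 than \<open>c\<close>.\<close>

lemma separator_before:
  fixes a c :: int
  assumes "2 ^ r dvd c" "\<not> 2 ^ r dvd a"
  obtains s where "s \<le> r" "2 ^ s dvd c - 2 * a" "\<not> 2 ^ s dvd a - c"
proof -
  obtain m where m: "2 ^ m dvd a" "\<not> 2 ^ Suc m dvd a" "m < r"
    using assms(2) by (rule exact_power_of_two)
  then have "(2::int) ^ Suc m dvd 2 ^ r" by (intro le_imp_power_dvd) simp
  then have c: "2 ^ Suc m dvd c" using assms(1) dvd_trans by blast
  have "2 ^ Suc m dvd 2 * a" using m(1) by simp
  with c have "2 ^ Suc m dvd c - 2 * a" by (rule dvd_diff)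
  moreover have "\<not> 2 ^ Suc m dvd a - c" using m(2) dvd_add[OF _ c, of "a - c"] by auto
  ultimately show thesis using m(3) by (intro that[of "Suc m"]) auto
qed

lemma separator_bound:
  fixes a c :: int
  assumes "2 ^ s dvd c - 2 * a" "\<not> 2 ^ s dvd a - c" "2 ^ r dvd c" "\<not> 2 ^ Suc r dvd c"
  shows "\<not> 2 ^ r dvd a"
proof
  assume a: "2 ^ r dvd a"
  then have "2 ^ r dvd a - c" using assms(3) by (rule dvd_diff)
  then have "\<not> s \<le> r" using assms(2) le_imp_power_dvd dvd_trans by blast
  then have "(2::int) ^ Suc r dvd 2 ^ s" by (intro le_imp_power_dvd) simp
  then have "2 ^ Suc r dvd c - 2 * a" using assms(1) dvd_trans by blast
  moreover have "2 ^ Suc r dvd 2 * a" using a by simp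
  ultimately have "2 ^ Suc r dvd (c - 2 * a) + 2 * a" by (rule dvd_add)
  then have "2 ^ Suc r dvd c" by simp
  then show False using assms(4) by blast
qed

context generic_tiling begin

text \<open>The step from one tile of a w-line to the next is three times the vector \<open>w\<close> from the centre
  of the hexagon to its vertex.\<close>

lemma R2_step:
  assumes y: "y \<in> Q"
  shows "y + \<i> * a_unit j / of_real (sqrt 3) \<in> red y (\<Lambda> y) \<longleftrightarrow>
    y + frame_point j 1 2 - \<i> * a_unit j / of_real (sqrt 3)
      \<in> blue (y + frame_point j 1 2) (\<Lambda> (y + frame_point j 1 2))"
proof -
  define w where "w = \<i> * a_unit j / of_real (sqrt 3)"
  have w: "w \<in> Omega" "frame_point j 1 2 = 3 * w"
    unfolding w_def by (rule vertex_in_Omega, rule frame_point_12)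
  have "y + w \<in> red y (\<Lambda> y) \<longleftrightarrow> y + 2 * w \<in> blue (y + 3 * w) (\<Lambda> (y + 3 * w))"
    using tiling y w(1) unfolding X_Q_def R2_def by blast
  moreover have "y + 2 * w = y + 3 * w - w" by (simp add: algebra_simps)
  ultimately show ?thesis unfolding w(2) w_def[symmetric] by simp
qed

text \<open>Within a run of split diagonals the colour at an end is reversed twice from one tile to the
  next: by R2 between the facing ends, and by the split between the two ends of one diagonal.\<close>

lemma red_side_propagates:
  assumes x: "x \<in> Q" and "p > 0"
    and "\<And>t. t < p \<Longrightarrow>
      stripe_dir (\<Lambda> (x + of_nat t * frame_point j 1 2)) \<in> {a_unit j, - a_unit j}"
  defines "y \<equiv> x + of_nat p * frame_point j 1 2"
  shows "red_side (\<Lambda> x) = \<i> * a_unit j \<longleftrightarrow> y - \<i> * a_unit j / of_real (sqrt 3) \<in> blue y (\<Lambda> y)"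
  using assms(2,3) unfolding y_def
proof (induction p rule: nat_induct_non_zero)
  case 1
  then show ?case using R2_step[OF x, of j] vertex_colours(1)[OF tile[OF x]] by force
next
  case (Suc p)
  define z where "z = x + of_nat p * frame_point j 1 2"
  have "of_nat p * frame_point j 1 2 \<in> Q"
    using frame_point_arith(3)[of "int p" j 1 2] by (simp add: frame_point_in_Q)
  then have z: "z \<in> Q" unfolding z_def by (rule Q_add[OF x])
  have "stripe_dir (\<Lambda> z) \<in> {a_unit j, - a_unit j}" using Suc.prems[of p] unfolding z_def by simp
  note cols = vertex_colours(1,2)[OF tile[OF z] this, of z]
  have "red_side (\<Lambda> x) = \<i> * a_unit j \<longleftrightarrow> z - \<i> * a_unit j / of_real (sqrt 3) \<in> blue z (\<Lambda> z)"
    unfolding z_def using Suc.IH Suc.prems by simp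
  also have "\<dots> \<longleftrightarrow> z + \<i> * a_unit j / of_real (sqrt 3) \<in> red z (\<Lambda> z)" using cols by simp
  also have "\<dots> \<longleftrightarrow> z + frame_point j 1 2 - \<i> * a_unit j / of_real (sqrt 3)
      \<in> blue (z + frame_point j 1 2) (\<Lambda> (z + frame_point j 1 2))"
    by (rule R2_step[OF z])
  also have "z + frame_point j 1 2 = x + of_nat (Suc p) * frame_point j 1 2"
    by (simp add: z_def algebra_simps)
  finally show ?case .
qed

text \<open>The run of equal stripe directions starting at \<open>x\<close> ends after \<open>z mod 2 ^ r\<close> steps, where \<open>z\<close> is the
  coordinate \<open>j + 2\<close> of \<open>x\<close>.  At that place \<open>z\<close> has become \<open>2 ^ r * (z div 2 ^ r)\<close>.  If the quotient is even, that
  coordinate has more factors 2 than \<open>c\<close>, so the stripe direction is \<open>j + 2\<close>; if it is odd, the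
  difference with \<open>c\<close>, which is coordinate \<open>j + 1\<close>, has more factors 2 than \<open>c\<close>.\<close>

lemma red_side_iff:
  assumes x: "x \<in> Q" and st: "stripe_dir (\<Lambda> x) \<in> {a_unit j, - a_unit j}"
    and sep: "2 ^ s dvd triple (x - v k) j" "\<not> 2 ^ s dvd triple (x - v k) (j + 1)"
    and r: "2 ^ r dvd triple (x - v k) (j + 2) - triple (x - v k) (j + 1)"
      "\<not> 2 ^ Suc r dvd triple (x - v k) (j + 2) - triple (x - v k) (j + 1)" "r < k"
  shows "red_side (\<Lambda> x) = \<i> * a_unit j \<longleftrightarrow> even (triple (x - v k) (j + 2) div 2 ^ r)"
proof -
  define a where "a = triple (x - v k) (j + 2)"
  define c where "c = a - triple (x - v k) (j + 1)"
  have xQ: "x - v k \<in> Q" by (rule Q_diff[OF x v_in_Q])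
  have c: "2 ^ r dvd c" "\<not> 2 ^ Suc r dvd c" using r unfolding c_def a_def by auto
  define y where "y t = x + of_nat t * frame_point j 1 2" for t
  have step: "of_nat t * frame_point j 1 2 = frame_point j (int t) (2 * int t)" for t
    using frame_point_arith(3)[of "int t" j 1 2] by (simp add: mult.commute)
  have y: "y t \<in> Q" for t unfolding y_def step by (intro Q_add x frame_point_in_Q)
  have "y t - v k = (x - v k) + frame_point j (int t) (2 * int t)" for t
    unfolding y_def step by simp
  then have tr: "triple (y t - v k) i = triple (x - v k) i + triple (frame_point j (int t) (2 * int t)) i"
    for t i using triple_add[OF xQ frame_point_in_Q] by metis
  have tr1: "triple (y t - v k) (j + 1) = (a - t) - c" for t
    unfolding tr triple_frame_point by (simp add: c_def)
  have tr2: "triple (y t - v k) (j + 2) = a - t" for t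
    unfolding tr triple_frame_point by (simp add: a_def)
  have tr0: "triple (y t - v k) j = c - 2 * (a - t)" for t
    using triple_sum[OF Q_diff[OF y v_in_Q], of t k j] tr1 tr2 by simp
  have y0: "y 0 = x" by (simp add: y_def)
  \<comment> \<open>\<open>x\<close> itself has stripe direction \<open>j\<close>, so the run ends strictly beyond \<open>x\<close>\<close>
  have na: "\<not> 2 ^ r dvd a"
    by (rule separator_bound[OF _ _ c, of s]) (use sep tr0[of 0] tr1[of 0] y0 in auto)
  define p where "p = nat (a mod 2 ^ r)"
  have p: "int p = a mod 2 ^ r" by (simp add: p_def)
  have "p > 0" using na p by (metis dvd_eq_mod_eq_0 gr0I of_nat_0)
  have before: "stripe_dir (\<Lambda> (y t)) \<in> {a_unit j, - a_unit j}" if "t < p" for t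
  proof -
    have "a mod 2 ^ r < 2 ^ r" by simp
    then have "0 < int p - int t" "int p - int t < 2 ^ r" using that p by linarith+
    then have "\<not> 2 ^ r dvd (int p - int t)" by (meson zdvd_not_zless)
    moreover have "a - t = 2 ^ r * (a div 2 ^ r) + (int p - int t)"
      unfolding p by (simp add: minus_mod_eq_mult_div [symmetric])
    ultimately have "\<not> 2 ^ r dvd (a - t)" by (metis dvd_add_right_iff dvd_triv_left)
    then obtain s' where "s' \<le> r" "2 ^ s' dvd c - 2 * (a - t)" "\<not> 2 ^ s' dvd (a - t) - c"
      using separator_before[OF c(1)] by blast
    then show ?thesis using r(3) stripe_dir_eqI[OF y[of t], of s' k j] unfolding tr0 tr1 by simp
  qed
  have col: "red_side (\<Lambda> x) = \<i> * a_unit j \<longleftrightarrow> y p - \<i> * a_unit j / of_real (sqrt 3) \<in> blue (y p) (\<Lambda> (y p))"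
    unfolding y_def by (rule red_side_propagates[OF x \<open>p > 0\<close>]) (use before in \<open>simp add: y_def\<close>)
  have ap: "a - p = 2 ^ r * (a div 2 ^ r)"
    unfolding p by (simp add: minus_mod_eq_mult_div)
  have le: "Suc r \<le> k" using r(3) by simp
  show ?thesis
  proof (cases "even (a div 2 ^ r)")
    case True
    then have d: "2 ^ Suc r dvd a - p" unfolding ap by (auto simp: mult.commute)
    then have "2 ^ Suc r dvd 2 * (a - p)" by (rule dvd_mult)
    then have "\<not> 2 ^ Suc r dvd c - 2 * (a - p)" using c(2) dvd_add[of _ "c - 2 * (a - p)"] by fastforce
    then have "stripe_dir (\<Lambda> (y p)) \<in> {a_unit (j + 2), - a_unit (j + 2)}"
      using d by (intro stripe_dir_eqI[OF y le]) (simp_all only: tr2 add.assoc, use tr0[of p] triple_add3[of "y p - v k" j] in \<open>simp add: numeral_3_eq_3\<close>)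
    then show ?thesis using col vertex_colours(4)[OF tile[OF y]] True unfolding a_def[symmetric] by blast
  next
    case False
    then obtain b where b: "a div 2 ^ r = 2 * b + 1" by (elim oddE)
    have d: "\<not> 2 ^ Suc r dvd a - p" unfolding ap b by (simp add: mult.commute)
    obtain c' where c': "c = 2 ^ r * c'" using c(1) by (auto simp: dvd_def)
    have "odd c'" using c(2) unfolding c' by (auto simp: mult.commute)
    then have "even ((2 * b + 1) - c')" by simp
    then obtain e where e: "(2 * b + 1) - c' = 2 * e" by (elim evenE)
    have "(a - p) - c = 2 ^ r * ((2 * b + 1) - c')"
      unfolding ap b c' by (simp add: right_diff_distrib)
    then have "2 ^ Suc r dvd (a - p) - c" unfolding e by simp
    then have "stripe_dir (\<Lambda> (y p)) \<in> {a_unit (j + 1), - a_unit (j + 1)}"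
      using d by (intro stripe_dir_eqI[OF y le]) (use tr1[of p] tr2[of p] in \<open>simp_all\<close>)
    then show ?thesis using col vertex_colours(3)[OF tile[OF y]] False unfolding a_def[symmetric] by blast
  qed
qed

text \<open>The displaced stripe crosses the split diagonal at distance \<open>eps\<close> from the centre, on the side of
  its displacement; the half diagonal is longer than \<open>eps\<close> because \<open>1 / 4 \<le> 1 / sqrt 3\<close>.\<close>

lemma white_iff:
  assumes x: "x \<in> Q"
  shows "white eps x (\<Lambda> x) \<longleftrightarrow> stripe_side (\<Lambda> x) = red_side (\<Lambda> x)"
proof -
  define d n where "d = stripe_dir (\<Lambda> x)" and "n = stripe_side (\<Lambda> x)"
  have "d \<in> a_dirs" and n: "n \<in> {\<i> * d, - (\<i> * d)}" and rs: "red_side (\<Lambda> x) \<in> {\<i> * d, - (\<i> * d)}"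
    using tile[OF x] unfolding is_tile_def d_def n_def by auto
  then have "d \<noteq> 0" by (metis a_dirs_a_unit a_unit_nonzero neg_0_equal_iff_equal)
  show ?thesis
  proof
    assume eq: "stripe_side (\<Lambda> x) = red_side (\<Lambda> x)"
    define t where "t = eps * sqrt 3"
    have "sqrt 3 \<le> 2" by (rule real_le_lsqrt) auto
    then have "eps * sqrt 3 \<le> 1 / 4 * 2" using eps by (intro mult_mono) auto
    then have t: "0 \<le> t" "t \<le> 1" using eps by (simp_all add: t_def)
    have "x + of_real eps * n = (1 - t) *\<^sub>R x + t *\<^sub>R (x + n / of_real (sqrt 3))"
      by (simp add: t_def scaleR_conv_of_real field_simps)
    then have "x + of_real eps * n \<in> half_diagonal x (red_side (\<Lambda> x))"
      unfolding half_diagonal_def closed_segment_def eq[symmetric] n_def using t by blast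
    moreover have "x + of_real eps * n = (1 - 1 / 2) *\<^sub>R (x + of_real eps * n - d / 2) +
        (1 / 2) *\<^sub>R (x + of_real eps * n + d / 2)"
      by (simp add: scaleR_conv_of_real field_simps)
    then have "x + of_real eps * n \<in> stripe eps x (\<Lambda> x)"
      unfolding stripe_def closed_segment_def n_def[symmetric] d_def[symmetric] mem_Collect_eq 
      by (intro exI[of _ "1 / 2"]) simp
    ultimately show "white eps x (\<Lambda> x)" unfolding white_def by blast
  next
    assume "white eps x (\<Lambda> x)"
    then obtain p where p: "p \<in> stripe eps x (\<Lambda> x)" "p \<in> half_diagonal x (red_side (\<Lambda> x))"
      unfolding white_def by blast
    show "stripe_side (\<Lambda> x) = red_side (\<Lambda> x)"
    proof (rule ccontr)
      assume "stripe_side (\<Lambda> x) \<noteq> red_side (\<Lambda> x)"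
      then have rs': "red_side (\<Lambda> x) = - n" using n rs unfolding n_def[symmetric] by auto
      define h where "h = d / 2"
      obtain s where "p = (1 - s) *\<^sub>R (x + of_real eps * n - h) + s *\<^sub>R (x + of_real eps * n + h)"
        using p(1) unfolding stripe_def closed_segment_def n_def[symmetric] d_def[symmetric] h_def
        by blast
      then have "p - x = of_real eps * n + of_real (2 * s - 1) * h"
        by (simp add: scaleR_conv_of_real algebra_simps)
      also have "of_real (2 * s - 1) * h = of_real (s - 1 / 2) * d"
        by (simp add: h_def field_simps)
      finally have 1: "p - x = of_real eps * n + of_real (s - 1 / 2) * d" .
      obtain t where t: "0 \<le> t" "p = (1 - t) *\<^sub>R x + t *\<^sub>R (x + - n / of_real (sqrt 3))"
        using p(2) unfolding half_diagonal_def closed_segment_def rs' by blast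
      then have 2: "p - x = - of_real (t / sqrt 3) * n"
        by (simp add: scaleR_conv_of_real field_simps)
      have "of_real (eps + t / sqrt 3) * n = of_real (1 / 2 - s) * d"
        using 1 2 by (simp add: algebra_simps)
      moreover obtain \<sigma> :: real where "n = of_real \<sigma> * \<i> * d" "\<sigma> = 1 \<or> \<sigma> = - 1"
      proof -
        have "n = of_real 1 * \<i> * d \<or> n = of_real (- 1) * \<i> * d" using n by auto
        then show thesis using that by blast
      qed
      ultimately have "(of_real (eps + t / sqrt 3) * of_real \<sigma> * \<i>) * d = of_real (1 / 2 - s) * d"
        by (simp add: algebra_simps)
      then have "of_real (eps + t / sqrt 3) * of_real \<sigma> * \<i> = of_real (1 / 2 - s)"
        using \<open>d \<noteq> 0\<close> mult_cancel_right by blast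
      then have "(eps + t / sqrt 3) * \<sigma> = 0" by (simp add: complex_eq_iff)
      moreover have "eps + t / sqrt 3 > 0" using eps t(1) by (simp add: add_pos_nonneg)
      ultimately show False using \<open>\<sigma> = 1 \<or> \<sigma> = - 1\<close> by auto
    qed
  qed
qed
end

section \<open>The parity formula\<close>

lemma D_eqI: "2 ^ r dvd z \<Longrightarrow> \<not> 2 ^ Suc r dvd z \<Longrightarrow> D z = enat (2 ^ r)"
  unfolding D_def using multiplicity_eqI[of "2 :: int" r z] by auto

lemma D_less:
  assumes "2 ^ s dvd a" "\<not> 2 ^ s dvd b" shows "D b < D a"
proof -
  obtain r where r: "2 ^ r dvd b" "\<not> 2 ^ Suc r dvd b" "r < s"
    using assms(2) by (rule exact_power_of_two)
  show ?thesis
  proof (cases "a = 0")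
    case True
    then show ?thesis using D_eqI[OF r(1,2)] by (simp add: D_def)
  next
    case False
    then have "s \<le> multiplicity 2 a" using assms(1) by (simp add: power_dvd_iff_le_multiplicity)
    then have "r < multiplicity 2 a" using r(3) by simp
    then have "(2::nat) ^ r < 2 ^ multiplicity 2 a" by simp
    then show ?thesis using D_eqI[OF r(1,2)] False by (simp add: D_def)
  qed
qed

lemma floor_quot_eq:
  assumes "2 ^ r dvd z" "\<not> 2 ^ Suc r dvd z" shows "floor_quot y z = y div 2 ^ r"
proof -
  have "floor_quot y z = \<lfloor>real_of_int y / real_of_int (2 ^ r)\<rfloor>"
    unfolding floor_quot_def D_eqI[OF assms] by simp
  then show ?thesis unfolding floor_divide_of_int_eq .
qed

lemma max_index_eqI:
  assumes "j \<in> {1, 2, 3}"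
    and "D (triple x (j + 1)) < D (triple x j)" "D (triple x (j + 2)) < D (triple x j)"
  shows "max_index x = j"
proof -
  have tr: "triple x 4 = triple x 1" "triple x 5 = triple x 2"
    by (simp_all add: triple_def)
  have "D (triple x i) < D (triple x j)" if "i \<in> {1, 2, 3}" "i \<noteq> j" for i
    using that assms tr by (auto simp: numeral_eq_Suc)
  then have less: "i \<in> {1, 2, 3} \<Longrightarrow> D (triple x j) \<le> D (triple x i) \<Longrightarrow> i = j" for i
    by (meson not_le)
  have max: "D (triple x i) \<le> D (triple x j)" if "i \<in> {1, 2, 3}" for i
    using less[OF that] by (metis linear order_refl)
  show ?thesis unfolding max_index_def
  proof (rule some_equality)
    show "j \<in> {1, 2, 3} \<and> (\<forall>i\<in>{1, 2, 3}. D (triple x i) \<le> D (triple x j))"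
      using assms(1) max by blast
    show "i = j" if "i \<in> {1, 2, 3} \<and> (\<forall>h\<in>{1, 2, 3}. D (triple x h) \<le> D (triple x i))" for i
      using that assms(1) less by blast
  qed
qed

context generic_tiling begin

text \<open>The first summand of the parity function is even exactly if the red half is on the side \<open>\<i> * a_unit j\<close>,
  the second one exactly if the stripe is displaced to the other side.  So their sum is odd exactly if the
  two sides agree.\<close>

lemma parity_fun_eq_tile_parity:
  assumes x: "x \<in> Q" and j: "j \<in> {1, 2, 3}" "stripe_dir (\<Lambda> x) \<in> {a_unit j, - a_unit j}"
    and ndvd: "\<not> 2 ^ k dvd triple (x - v k) j"
      "\<not> 2 ^ k dvd triple (x - v k) (j + 2) - triple (x - v k) (j + 1)"
  shows "parity_fun (x - v k) = Some (tile_parity eps x (\<Lambda> x))"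
proof -
  define N where "N = triple (x - v k) j"
  define y where "y = triple (x - v k) (j + 1)"
  define z where "z = triple (x - v k) (j + 2)"
  have sum: "N + y + z = 0" unfolding N_def y_def z_def by (rule triple_sum[OF Q_diff[OF x v_in_Q]])
  obtain l where l: "a_level q (line_through x (a_unit j)) = enat l" using a_level_finite[OF x] by auto
  have "l < k" using a_level_ge_iff[OF q x, of k k j] ndvd(1) l by simp
  have lN: "2 ^ l dvd N" "\<not> 2 ^ Suc l dvd N"
    using a_level_ge_iff[OF q x, of l k j] a_level_ge_iff[OF q x, of "Suc l" k j] \<open>l < k\<close> l
    by (simp_all add: N_def)
  have ly: "\<not> 2 ^ l dvd y" and lz: "\<not> 2 ^ l dvd z"
    using stripe_level_greatest[OF x j(2) a_unit_not_parallel(1)]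
      stripe_level_greatest[OF x j(2) a_unit_not_parallel(2)]
      a_level_ge_iff[OF q x, of l k "j + 1"] a_level_ge_iff[OF q x, of l k "j + 2"] \<open>l < k\<close> l
    unfolding y_def z_def by auto
  obtain r where r: "2 ^ r dvd z - y" "\<not> 2 ^ Suc r dvd z - y" "r < k"
    using ndvd(2) unfolding y_def[symmetric] z_def[symmetric] by (rule exact_power_of_two)
  have "max_index (x - v k) = j"
    using j(1) lN(1) ly lz unfolding N_def y_def z_def by (intro max_index_eqI D_less)
  moreover have zy: "z + y = - N" using sum by simp
  moreover have "floor_quot z (z + y) = z div 2 ^ l"
    by (rule floor_quot_eq) (use lN in \<open>simp_all add: zy\<close>)
  moreover have "N \<noteq> 0" "z - y \<noteq> 0" using lN(2) r(2) by auto
  then have "y + z \<noteq> 0" "y - z \<noteq> 0" using zy by auto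
  ultimately have pf: "parity_fun (x - v k) = Some ((z div 2 ^ r + z div 2 ^ l) mod 2)"
    using floor_quot_eq[OF r(1,2), of z]
    by (simp add: parity_fun_def Let_def y_def z_def)
  have red: "red_side (\<Lambda> x) = \<i> * a_unit j \<longleftrightarrow> even (z div 2 ^ r)"
    unfolding z_def by (rule red_side_iff[OF x j(2)]) (use lN(1) ly r in \<open>simp_all add: N_def y_def z_def\<close>)
  obtain N' where N': "N = 2 ^ l * N'" using lN(1) by (auto simp: dvd_def)
  have "odd N'" using lN(2) unfolding N' by (auto simp: mult.commute)
  have "- y = z + N' * 2 ^ l" using sum N' mult.commute[of N' "2 ^ l"] by linarith
  then have "- y div 2 ^ l = N' + z div 2 ^ l" by simp
  then have side: "stripe_side (\<Lambda> x) = \<i> * a_unit j \<longleftrightarrow> odd (z div 2 ^ l)"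
    using stripe_side_iff[OF x j(2) l \<open>l < k\<close>] \<open>odd N'\<close> unfolding y_def[symmetric] by simp
  have "stripe_side (\<Lambda> x) \<in> {\<i> * a_unit j, - (\<i> * a_unit j)}" "red_side (\<Lambda> x) \<in> {\<i> * a_unit j, - (\<i> * a_unit j)}"
    using tile[OF x] j(2) unfolding is_tile_def by auto
  then have "stripe_side (\<Lambda> x) = red_side (\<Lambda> x) \<longleftrightarrow>
      (stripe_side (\<Lambda> x) = \<i> * a_unit j \<longleftrightarrow> red_side (\<Lambda> x) = \<i> * a_unit j)"
    by auto
  moreover define n where "n = z div 2 ^ r + z div 2 ^ l"
  ultimately have "white eps x (\<Lambda> x) \<longleftrightarrow> odd n"
    unfolding white_iff[OF x] red side by auto
  then show ?thesis unfolding pf tile_parity_def n_def[symmetric] by (simp add: mod_2_eq_odd)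
qed

end

theorem corollary8p4:
  fixes eps :: real and \<Lambda> :: "complex \<Rightarrow> tile" and q :: "(nat \<Rightarrow> complex) set"
  assumes "0 < eps" and "eps \<le> 1 / 4"
    and "\<Lambda> \<in> X_Q eps"
    and "is_xi \<Lambda> q"
    and "generic q"
  shows "\<forall>x\<in>Q. parity_fun_at q x = Some (tile_parity eps x (\<Lambda> x))"
proof
  fix x assume x: "x \<in> Q"
  define p where "p = tile_parity eps x (\<Lambda> x)"
  have Qbar: "q \<in> Qbar" using assms(4) unfolding is_xi_def by blast
  have "stripe_dir (\<Lambda> x) \<in> a_dirs" using assms(3) x unfolding X_Q_def is_tile_def by blast
  then obtain j where j: "j \<in> {1, 1 + 1, 1 + 2}" "stripe_dir (\<Lambda> x) = a_unit j \<or> stripe_dir (\<Lambda> x) = - a_unit j"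
    by (rule a_dirs_a_unit)
  then have j': "j \<in> {1, 2, 3}" "stripe_dir (\<Lambda> x) \<in> {a_unit j, - a_unit j}" by auto
  have "eventual_parity q x p" unfolding eventual_parity_def
  proof (intro allI impI)
    fix v assume v: "represents v q"
    interpret generic_tiling eps \<Lambda> q v using assms v by unfold_locales
    show "\<forall>\<^sub>F k in sequentially. parity_fun (x - v k) = Some p"
      using generic_eventually_not_dvd[OF Qbar v assms(5) x, of j]
      by eventually_elim (unfold p_def, rule parity_fun_eq_tile_parity[OF x j'])
  qed
  moreover have "p' = p" if "eventual_parity q x p'" for p'
  proof -
    obtain v where "represents v q" using Qbar by (rule represents_exists)
    then have "\<forall>\<^sub>F k in sequentially. parity_fun (x - v k) = Some p'"
        "\<forall>\<^sub>F k in sequentially. parity_fun (x - v k) = Some p"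
      using that \<open>eventual_parity q x p\<close> unfolding eventual_parity_def by blast+
    then have "\<forall>\<^sub>F k in sequentially. p' = p" by eventually_elim simp
    then show ?thesis by simp
  qed
  ultimately have "\<exists>!p. eventual_parity q x p" "(THE p. eventual_parity q x p) = p" by blast+
  then show "parity_fun_at q x = Some (tile_parity eps x (\<Lambda> x))"
    unfolding parity_fun_at_def p_def[symmetric] by simp
qed

end
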